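(* Let $\alpha\in(\tfrac14,\tfrac12]$, $s\in(\tfrac12-\alpha,2\alpha)$, let $\varepsilon>0$ be arbitrarily small, and let $u_0^\omega=\sum_{n\in\mathbb Z}\frac{g_n(\omega)}{\langle n\rangle^\alpha}e^{inx}$. Let $\Sigma\subset\Omega$ be a set with $\mathbb P(\Sigma)=1$ such that for every $\omega\in\Sigma$ there exist $T^\omega>0$ and a unique solution $u^\omega$ to the BBM equation on $[0,T^\omega]$ with $u^\omega|_{t=0}=u_0^\omega$ in the class $e^{-it\varphi(D_x)}u_0^\omega+C([0,T^\omega];H^s(\mathbb T))\subset C([0,T^\omega];H^{\alpha-\frac12-\varepsilon}(\mathbb T))$. Fix $\omega\in\Sigma$. Then there exist, for $k\in\mathbb N$, smooth (random) solutions $u_k^\omega$ to the BBM equation such that $$\lim_{k\to\infty}\|u_k^\omega(0)-u_0^\omega\|_{H^{\alpha-\frac12-\varepsilon}(\mathbb T)}=0\quad\text{and}\quad\lim_{k\to\infty}\|u_k^\omega-u^\omega\|_{C([0,k^{-1}];H^{\alpha-\frac12-\varepsilon}(\mathbb T))}=\infty.$$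
   Context: $\mathbb T=\mathbb R/(2\pi\mathbb Z)$, $\langle n\rangle=(1+n^2)^{1/2}$, $D_x=-i\partial_x$, and $\varphi(D_x)$ is the Fourier multiplier with symbol $\varphi(n)=\frac{n}{1+n^2}$; $S(t)=e^{-it\varphi(D_x)}$. $\{g_n\}_{n\in\mathbb Z}$ are standard complex-valued Gaussian random variables ($\mathbb E[g_n]=0$, $\mathbb E|g_n|^2=1$) on a probability space $(\Omega,\mathcal F,\mathbb P)$, with $g_{-n}=\overline{g_n}$, $g_0$ real, and $\{g_n\}_{n\ge0}$ independent. The BBM equation is $i\partial_tu=\varphi(D_x)u+\frac12\mathcal N(u)$ with $$\mathcal N(u)=\sum_{n\ne0}\varphi(n)e^{inx}\sum_{n_1+n_2=n}\widehat u(n_1)\widehat u(n_2);$$ for $u\in L^2(\mathbb T)$ one has $\mathcal N(u)=\varphi(D_x)(u^2)$ and the equation is equivalent to $\partial_tu-\partial_{xxt}u+\partial_xu+\tfrac12\partial_x(u^2)=0$. Solutions are understood via the Duhamel formula $u(t)=S(t)u_0-\frac i2\int_0^tS(t-t')\mathcal N(u(t'))\,dt'$. With $z=S(t)u_0^\omega$ and $u=z+v$, $v\in C([0,T];H^s(\mathbb T))$, the nonlinearity means $\mathcal N(u)=\varphi(D_x)(v^2+2zv)+\mathcal N(z)$, where in $\mathcal N(z)$ the inner sum for each $n\neq0$ is the limit in $L^2(\Omega)$ as $M\to\infty$ of the sums restricted to $|n_1|,|n_2|\le M$. A smooth solution is a real-valued solution in $\bigcap_\sigma C([0,\infty);H^\sigma(\mathbb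 T))$. The quantity on $[0,k^{-1}]$ is considered for $k$ large enough that $k^{-1}\le T^\omega$. *)

theory Defs
  imports "HOL-Probability.Probability"
begin

text \<open>
  A periodic distribution u on the torus R/(2 pi Z) is represented by the family of its Fourier
  coefficients n :: int, u = (sum over n of u n * exp (i n x)).  Every element of a Sobolev space
  below is a family of polynomial growth, hence a genuine distribution.
\<close>

type_synonym fourier = "int \<Rightarrow> complex"

definition jap :: "int \<Rightarrow> real"
  where "jap n = sqrt (1 + (real_of_int n)\<^sup>2)"

definition phi :: "int \<Rightarrow> real"
  where "phi n = real_of_int n / (1 + (real_of_int n)\<^sup>2)"

text \<open>The propagator \<open>S(t) = exp (- i t phi(D))\<close>.\<close>

definition propagator :: "real \<Rightarrow> fourier \<Rightarrow> fourier"
  where "propagator t f = (\<lambda>n. exp (- (\<i> * of_real (t * phi n))) * f n)"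

definition Hs :: "real \<Rightarrow> fourier set"
  where "Hs s = {f. (\<lambda>n. jap n powr (2 * s) * (cmod (f n))\<^sup>2) summable_on UNIV}"

text \<open>Only meaningful on \<open>Hs s\<close>, because a divergent \<open>infsum\<close> is 0.\<close>

definition Hs_norm :: "real \<Rightarrow> fourier \<Rightarrow> real"
  where "Hs_norm s f = sqrt (\<Sum>\<^sub>\<infinity>n. jap n powr (2 * s) * (cmod (f n))\<^sup>2)"

text \<open>\<open>C(I; H^s)\<close>.  Values outside \<open>I\<close> are unconstrained.\<close>

definition CHs :: "real set \<Rightarrow> real \<Rightarrow> (real \<Rightarrow> fourier) set"
  where "CHs I s = {u. (\<forall>t\<in>I. u t \<in> Hs s) \<and>
     (\<forall>t\<in>I. ((\<lambda>t'. Hs_norm s (\<lambda>n. u t' n - u t n)) \<longlongrightarrow> 0) (at t within I))}"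

text \<open>
  Fourier coefficients of a product of distributions; the product makes sense when
  all of the defining series converge (unconditionally, equivalently absolutely).
\<close>

definition product_defined :: "fourier \<Rightarrow> fourier \<Rightarrow> bool"
  where "product_defined f h \<longleftrightarrow> (\<forall>n. (\<lambda>m. f m * h (n - m)) summable_on UNIV)"

definition product :: "fourier \<Rightarrow> fourier \<Rightarrow> fourier"
  where "product f h = (\<lambda>n. \<Sum>\<^sub>\<infinity>m. f m * h (n - m))"

text \<open>
  \<open>u(t) = S(t) u0 - (i/2) \<integral>\<^sub>0\<^sup>t S(t - t') F(t') dt'\<close> for all t in \<open>I\<close>, the identity and the Lebesgue
  integral being taken in the sense of distributions, i.e. on each Fourier coefficient.
\<close>

definition duhamel :: "real set \<Rightarrow> fourier \<Rightarrow> (real \<Rightarrow> fourier) \<Rightarrow> (real \<Rightarrow> fourier) \<Rightarrow> bool"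
  where "duhamel I u0 F u \<longleftrightarrow> (\<forall>t\<in>I. \<forall>n.
     (\<lambda>t'. propagator (t - t') (F t') n) absolutely_integrable_on {0..t} \<and>
     u t n = propagator t u0 n - \<i> / 2 * integral {0..t} (\<lambda>t'. propagator (t - t') (F t') n))"

text \<open>
  The nonlinearity on smooth functions.  The mode n = 0 drops out because \<open>phi 0 = 0\<close>;
  on \<open>L\<^sup>2\<close> all products are defined.
\<close>

definition bbm_nonlinearity :: "fourier \<Rightarrow> fourier"
  where "bbm_nonlinearity u = (\<lambda>n. of_real (phi n) * product u u n)"

definition real_valued :: "fourier \<Rightarrow> bool"
  where "real_valued f \<longleftrightarrow> (\<forall>n. f (- n) = cnj (f n))"

definition smooth_bbm_solution :: "(real \<Rightarrow> fourier) \<Rightarrow> bool"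
  where "smooth_bbm_solution u \<longleftrightarrow>
     (\<forall>\<sigma>. u \<in> CHs {0..} \<sigma>) \<and> (\<forall>t\<ge>0. real_valued (u t)) \<and>
     duhamel {0..} (u 0) (\<lambda>t. bbm_nonlinearity (u t)) u"

text \<open>
  For \<open>n \<noteq> 0\<close> the standard complex Gaussian has independent centred real and imaginary parts of
  variance 1/2; \<open>g 0\<close> is a real standard Gaussian.
\<close>

definition standard_gaussians :: "'w measure \<Rightarrow> (int \<Rightarrow> 'w \<Rightarrow> complex) \<Rightarrow> bool"
  where "standard_gaussians M g \<longleftrightarrow>
     (\<forall>n. g n \<in> borel_measurable M) \<and>
     (\<forall>n. n \<noteq> 0 \<longrightarrow>
        distributed M lborel (\<lambda>\<omega>. Re (g n \<omega>)) (\<lambda>x. ennreal (normal_density 0 (1 / sqrt 2) x)) \<and>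
        distributed M lborel (\<lambda>\<omega>. Im (g n \<omega>)) (\<lambda>x. ennreal (normal_density 0 (1 / sqrt 2) x)) \<and>
        prob_space.indep_var M borel (\<lambda>\<omega>. Re (g n \<omega>)) borel (\<lambda>\<omega>. Im (g n \<omega>))) \<and>
     distributed M lborel (\<lambda>\<omega>. Re (g 0 \<omega>)) (\<lambda>x. ennreal (std_normal_density x)) \<and>
     (\<forall>\<omega>\<in>space M. Im (g 0 \<omega>) = 0) \<and>
     (\<forall>n. \<forall>\<omega>\<in>space M. g (- n) \<omega> = cnj (g n \<omega>)) \<and>
     prob_space.indep_vars M (\<lambda>_. borel) (\<lambda>n. g (int n)) (UNIV :: nat set)"

definition random_data :: "(int \<Rightarrow> 'w \<Rightarrow> complex) \<Rightarrow> real \<Rightarrow> 'w \<Rightarrow> fourier"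
  where "random_data g \<alpha> \<omega> = (\<lambda>n. g n \<omega> / of_real (jap n powr \<alpha>))"

text \<open>The linear evolution \<open>z = S(t) u0\<close> of the random data.\<close>

definition random_linear :: "(int \<Rightarrow> 'w \<Rightarrow> complex) \<Rightarrow> real \<Rightarrow> 'w \<Rightarrow> real \<Rightarrow> fourier"
  where "random_linear g \<alpha> \<omega> t = propagator t (random_data g \<alpha> \<omega>)"

definition truncated_square :: "nat \<Rightarrow> fourier \<Rightarrow> fourier"
  where "truncated_square N f =
     (\<lambda>n. \<Sum>m | \<bar>m\<bar> \<le> int N \<and> \<bar>n - m\<bar> \<le> int N. f m * f (n - m))"

text \<open>
  \<open>Q \<omega> t n\<close> is the n-th Fourier coefficient of the square of z(t): for each \<open>n \<noteq> 0\<close> and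
  \<open>t \<ge> 0\<close> it is a version of the \<open>L\<^sup>2(\<Omega>)\<close> limit of the truncated coefficients.  Such a limit is
  determined only almost surely, so that Q is not a function of g.
\<close>

definition L2_limit_square ::
    "'w measure \<Rightarrow> ('w \<Rightarrow> real \<Rightarrow> fourier) \<Rightarrow> ('w \<Rightarrow> real \<Rightarrow> fourier) \<Rightarrow> bool"
  where "L2_limit_square M z Q \<longleftrightarrow> (\<forall>n t. n \<noteq> 0 \<longrightarrow> 0 \<le> t \<longrightarrow>
     (\<lambda>\<omega>. Q \<omega> t n) \<in> borel_measurable M \<and>
     (\<lambda>N. \<integral>\<^sup>+ \<omega>. ennreal ((cmod (truncated_square N (z \<omega> t) n - Q \<omega> t n))\<^sup>2) \<partial>M)
       \<longlonglongrightarrow> 0)"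

text \<open>
  The nonlinearity at \<open>u = z + v\<close>, namely \<open>phi(D) (v\<^sup>2 + 2 z v) + N(z)\<close>, where q holds the
  coefficients of the square of z.  The value \<open>q 0\<close> is irrelevant since \<open>phi 0 = 0\<close>.
\<close>

definition split_nonlinearity :: "fourier \<Rightarrow> fourier \<Rightarrow> fourier \<Rightarrow> fourier"
  where "split_nonlinearity q z v =
     (\<lambda>n. of_real (phi n) * (product v v n + 2 * product z v n) + of_real (phi n) * q n)"

text \<open>The class \<open>S(t) u0 + C([0,T]; H^s)\<close>.\<close>

definition solution_class :: "real \<Rightarrow> real \<Rightarrow> fourier \<Rightarrow> (real \<Rightarrow> fourier) set"
  where "solution_class T s u0 = {u. (\<lambda>t n. u t n - propagator t u0 n) \<in> CHs {0..T} s}"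

text \<open>
  Solutions on \<open>[0,T]\<close> in that class with initial value u0, where \<open>q t\<close> is the prescribed meaning
  of the square of \<open>S(t) u0\<close>.
\<close>

definition class_solution ::
    "real \<Rightarrow> real \<Rightarrow> fourier \<Rightarrow> (real \<Rightarrow> fourier) \<Rightarrow> (real \<Rightarrow> fourier) \<Rightarrow> bool"
  where "class_solution T s u0 q u \<longleftrightarrow>
     u \<in> solution_class T s u0 \<and> u 0 = u0 \<and>
     (let z = (\<lambda>t. propagator t u0); v = (\<lambda>t n. u t n - z t n) in
       (\<forall>t\<in>{0..T}. product_defined (v t) (v t) \<and> product_defined (z t) (v t)) \<and>
       duhamel {0..T} u0 (\<lambda>t. split_nonlinearity (q t) (z t) (v t)) u)"

definition unique_class_solution ::
    "real \<Rightarrow> real \<Rightarrow> fourier \<Rightarrow> (real \<Rightarrow> fourier) \<Rightarrow> (real \<Rightarrow> fourier) \<Rightarrow> bool"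
  where "unique_class_solution T s u0 q u \<longleftrightarrow>
     class_solution T s u0 q u \<and>
     (\<forall>w. class_solution T s u0 q w \<longrightarrow> (\<forall>t\<in>{0..T}. w t = u t))"

end

theory Submission
  imports Defs
begin

text \<open>
  The theorem is an instance of norm inflation: near every real-valued \<open>u\<^sub>0\<close> in \<open>H\<^sup>\<sigma>\<close> with
  \<open>\<sigma> < 0\<close> there are smooth solutions whose first Fourier mode becomes as large as one likes within
  an arbitrarily short time (\<open>norm_inflation\<close>).  The solution \<open>u\<close> of the theorem is bounded in
  \<open>H\<^sup>\<sigma>\<close> on a time interval, hence so is its first mode, and the difference must be large.

  The mechanism is the transfer of energy from high to low frequencies.  The initial value is
  \<open>p + A h\<close>, where \<open>p\<close> is a frequency truncation of \<open>u\<^sub>0\<close> and \<open>h\<close> has coefficient 1 at the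
  frequencies \<open>N\<close>, \<open>N + 1\<close> and their negatives.  Since \<open>\<sigma> < 0\<close>, the \<open>H\<^sup>\<sigma>\<close> norm of \<open>A h\<close>
  is of size \<open>A N\<^sup>\<sigma>\<close> and tends to 0 as \<open>N\<close> grows, however large \<open>A\<close> is.  In the square of the
  initial value the frequencies \<open>N + 1\<close> and \<open>- N\<close> meet at frequency 1 and contribute \<open>2 A\<^sup>2\<close>,
  so that the first mode starts to move with speed about \<open>A\<^sup>2 / 2\<close>.  At time \<open>t = c / A\<close> it has
  travelled a distance \<open>c A / 2\<close>.  All corrections are of size \<open>c\<^sup>2 A\<close> or bounded
  (\<open>first_mode_expansion\<close>): in the Wiener algebra of absolutely convergent Fourier series, whose norm
  does not see \<open>N\<close>, the data have size of order \<open>A\<close> and the vector field of the equation has size of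
  order \<open>A\<^sup>2\<close>, so that the solution moves only by \<open>O(c A)\<close> up to time \<open>t\<close>.  For \<open>c = 1 / 1000\<close> the
  main term wins, and it tends to infinity with \<open>A\<close>.

  It remains to know that such data launch global smooth solutions (\<open>bbm_global_flow\<close>).  In the
  Wiener algebra the equation is an ordinary differential equation with a locally Lipschitz vector
  field, because \<open>\<phi>(D)\<close> is bounded there.  Damping the nonlinearity by a scalar that depends on the
  norm of the solution makes the field globally Lipschitz, and the damped equation has global
  solutions by Picard iteration.  A scalar factor does not destroy the conservation of
  \<open>\<Sum>n. (1 + n\<^sup>2) \<bar>u n\<bar>\<^sup>2\<close>, which dominates the Wiener norm; so if the damping sets in only beyond
  the resulting a priori bound, it never acts and the equation itself has been solved.  Smoothness
  propagates because \<open>\<phi>\<close> gains one derivative: a decay rate of the coefficients on a time interval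
  improves itself by one power of \<open>n\<close> (\<open>flow_coeff_lipschitz\<close>).
\<close>

section \<open>The Wiener algebra of real-valued functions\<close>

text \<open>
  Real-valuedness is built into the type.  The type is still a real Banach space, closed under
  products and under \<open>- i \<phi>(D)\<close>, so that solutions constructed in it are real-valued for free.
\<close>

typedef wiener = "{f :: fourier. (\<lambda>n. cmod (f n)) summable_on UNIV \<and> real_valued f}"
  morphisms coeff Wiener
  by (rule exI[of _ "\<lambda>_. 0"]) (simp add: real_valued_def)

setup_lifting type_definition_wiener

lemma coeff_abs_summable: "(\<lambda>n. cmod (coeff w n)) summable_on UNIV"
  using coeff[of w] by auto

lemma coeff_real_valued: "real_valued (coeff w)"
  using coeff[of w] by auto

lemma coeff_uminus_index: "coeff w (- n) = cnj (coeff w n)"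
  using coeff_real_valued[of w] by (auto simp: real_valued_def)

lemma coeff_Wiener:
  "(\<lambda>n. cmod (f n)) summable_on UNIV \<Longrightarrow> real_valued f \<Longrightarrow> coeff (Wiener f) = f"
  by (simp add: Wiener_inverse)

lemma wiener_eqI: "(\<And>n. coeff v n = coeff w n) \<Longrightarrow> v = w"
  by (simp add: coeff_inject[symmetric] fun_eq_iff)

lemma abs_summable_on_add:
  fixes f g :: "'a \<Rightarrow> 'b::real_normed_vector"
  assumes "(\<lambda>x. norm (f x)) summable_on A" "(\<lambda>x. norm (g x)) summable_on A"
  shows "(\<lambda>x. norm (f x + g x)) summable_on A"
  by (rule summable_on_comparison_test[OF summable_on_add[OF assms]])
     (simp_all add: norm_triangle_ineq)

instantiation wiener :: real_normed_vector
begin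

lift_definition zero_wiener :: wiener is "\<lambda>_. 0"
  by (simp add: real_valued_def)

lift_definition plus_wiener :: "wiener \<Rightarrow> wiener \<Rightarrow> wiener" is "\<lambda>f g n. f n + g n"
  by (auto simp: real_valued_def intro!: abs_summable_on_add)

lift_definition uminus_wiener :: "wiener \<Rightarrow> wiener" is "\<lambda>f n. - f n"
  by (auto simp: real_valued_def)

lift_definition minus_wiener :: "wiener \<Rightarrow> wiener \<Rightarrow> wiener" is "\<lambda>f g n. f n - g n"
  by (simp add: real_valued_def diff_conv_add_uminus abs_summable_on_add del: add_uminus_conv_diff)

lift_definition scaleR_wiener :: "real \<Rightarrow> wiener \<Rightarrow> wiener" is "\<lambda>r f n. r *\<^sub>R f n"
  by (auto simp: real_valued_def intro!: summable_on_cmult_right)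

definition norm_wiener :: "wiener \<Rightarrow> real"
  where "norm_wiener w = (\<Sum>\<^sub>\<infinity>n. cmod (coeff w n))"

definition dist_wiener :: "wiener \<Rightarrow> wiener \<Rightarrow> real"
  where "dist_wiener v w = norm (v - w)"

definition sgn_wiener :: "wiener \<Rightarrow> wiener"
  where "sgn_wiener w = inverse (norm w) *\<^sub>R w"

definition uniformity_wiener :: "(wiener \<times> wiener) filter"
  where "uniformity_wiener = (INF e\<in>{0<..}. principal {(x, y). dist x y < e})"

definition open_wiener :: "wiener set \<Rightarrow> bool"
  where "open_wiener U \<longleftrightarrow> (\<forall>x\<in>U. eventually (\<lambda>(x', y). x' = x \<longrightarrow> y \<in> U) uniformity)"

instance
proof
  fix x y :: wiener and a :: real
  show "(norm x = 0) = (x = 0)"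
  proof
    assume "norm x = 0"
    then have "cmod (coeff x n) = 0" for n
      by (intro nonneg_infsum_le_0D[of "\<lambda>n. cmod (coeff x n)" UNIV])
         (auto simp: norm_wiener_def coeff_abs_summable)
    then show "x = 0" by (intro wiener_eqI) (simp add: zero_wiener.rep_eq)
  next
    assume "x = 0" then show "norm x = 0" by (simp add: norm_wiener_def zero_wiener.rep_eq)
  qed
  have "norm (x + y) \<le> (\<Sum>\<^sub>\<infinity>n. cmod (coeff x n) + cmod (coeff y n))"
    unfolding norm_wiener_def plus_wiener.rep_eq
    by (intro infsum_mono summable_on_add abs_summable_on_add coeff_abs_summable norm_triangle_ineq)
  also have "\<dots> = norm x + norm y"
    unfolding norm_wiener_def by (intro infsum_add coeff_abs_summable)
  finally show "norm (x + y) \<le> norm x + norm y" .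
  show "norm (a *\<^sub>R x) = \<bar>a\<bar> * norm x"
    by (simp add: norm_wiener_def scaleR_wiener.rep_eq infsum_cmult_right')
qed (simp_all add: dist_wiener_def sgn_wiener_def uniformity_wiener_def open_wiener_def,
     (transfer; simp add: algebra_simps fun_eq_iff)+)

end

lemma coeff_simps [simp]:
  "coeff 0 n = 0" "coeff (v + w) n = coeff v n + coeff w n"
  "coeff (v - w) n = coeff v n - coeff w n" "coeff (- w) n = - coeff w n"
  "coeff (r *\<^sub>R w) n = r *\<^sub>R coeff w n"
  by (simp_all add: zero_wiener.rep_eq plus_wiener.rep_eq minus_wiener.rep_eq
      uminus_wiener.rep_eq scaleR_wiener.rep_eq)

lemma sum_coeff_le_norm: "finite A \<Longrightarrow> (\<Sum>n\<in>A. cmod (coeff w n)) \<le> norm w"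
  unfolding norm_wiener_def by (rule finite_sum_le_infsum) (auto simp: coeff_abs_summable)

lemma coeff_le_norm: "cmod (coeff w n) \<le> norm w"
  using sum_coeff_le_norm[of "{n}" w] by simp

lemma norm_wiener_leI:
  assumes "\<And>A. finite A \<Longrightarrow> (\<Sum>n\<in>A. cmod (coeff w n)) \<le> B"
  shows "norm w \<le> B"
  unfolding norm_wiener_def
  by (rule infsum_le_finite_sums) (auto simp: coeff_abs_summable assms)

lemma bounded_linear_coeff: "bounded_linear (\<lambda>w. coeff w n)"
  by (rule bounded_linear_intro[where K = 1]) (simp_all add: coeff_le_norm)

text \<open>
  The norm is a supremum of finite sums, each of which passes to a coefficientwise limit.
\<close>

lemma wiener_limit_bound:
  fixes X :: "nat \<Rightarrow> wiener"
  assumes "\<And>n. (\<lambda>j. coeff (X j) n) \<longlonglongrightarrow> l n" "eventually (\<lambda>j. norm (v - X j) \<le> e) sequentially"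
    and "finite A"
  shows "(\<Sum>n\<in>A. cmod (coeff v n - l n)) \<le> e"
proof (rule tendsto_upperbound[OF _ _ sequentially_bot])
  show "(\<lambda>j. \<Sum>n\<in>A. cmod (coeff v n - coeff (X j) n)) \<longlonglongrightarrow> (\<Sum>n\<in>A. cmod (coeff v n - l n))"
    by (intro tendsto_intros assms)
  show "eventually (\<lambda>j. (\<Sum>n\<in>A. cmod (coeff v n - coeff (X j) n)) \<le> e) sequentially"
    using assms(2)
  proof eventually_elim
    case (elim j)
    then show ?case using sum_coeff_le_norm[OF assms(3), of "v - X j"] by simp
  qed
qed

instance wiener :: banach
proof
  fix X :: "nat \<Rightarrow> wiener"
  assume X: "Cauchy X"
  define l where "l n = lim (\<lambda>j. coeff (X j) n)" for n
  have l: "(\<lambda>j. coeff (X j) n) \<longlonglongrightarrow> l n" for n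
    using bounded_linear.Cauchy[OF bounded_linear_coeff X, of n]
    unfolding l_def by (simp add: Cauchy_convergent_iff convergent_LIMSEQ_iff)
  have ev: "\<exists>M. \<forall>i\<ge>M. \<forall>A. finite A \<longrightarrow> (\<Sum>n\<in>A. cmod (coeff (X i) n - l n)) \<le> e" if "e > 0" for e
  proof -
    obtain M where M: "norm (X i - X j) < e" if "i \<ge> M" "j \<ge> M" for i j
      using CauchyD[OF X \<open>e > 0\<close>] by blast
    show ?thesis
    proof (intro exI[of _ M] allI impI)
      fix i A assume "i \<ge> M" "finite (A :: int set)"
      then show "(\<Sum>n\<in>A. cmod (coeff (X i) n - l n)) \<le> e"
        using M by (intro wiener_limit_bound[OF l])
          (auto simp: eventually_sequentially intro!: exI[of _ M] less_imp_le)
    qed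
  qed
  have "real_valued l"
    unfolding real_valued_def
  proof
    fix n
    have "(\<lambda>j. coeff (X j) (- n)) \<longlonglongrightarrow> cnj (l n)"
      unfolding coeff_uminus_index by (intro tendsto_intros l)
    then show "l (- n) = cnj (l n)" using l LIMSEQ_unique by blast
  qed
  moreover have "(\<lambda>n. cmod (l n)) summable_on UNIV"
  proof -
    obtain M where "\<And>A. finite A \<Longrightarrow> (\<Sum>n\<in>A. cmod (coeff (X M) n - l n)) \<le> 1"
      using ev[of 1] by auto
    then have "(\<lambda>n. cmod (coeff (X M) n - l n)) summable_on UNIV"
      by (intro nonneg_bdd_above_summable_on) (auto simp: bdd_above_def)
    from abs_summable_on_add[OF coeff_abs_summable[of "- X M"] this]
    show ?thesis by simp
  qed
  ultimately have lw: "coeff (Wiener l) = l" by (intro coeff_Wiener)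
  have "X \<longlonglongrightarrow> Wiener l"
  proof (rule LIMSEQ_I)
    fix r :: real assume "r > 0"
    then obtain M where M: "\<And>i A. i \<ge> M \<Longrightarrow> finite A \<Longrightarrow> (\<Sum>n\<in>A. cmod (coeff (X i) n - l n)) \<le> r / 2"
      using ev[of "r / 2"] by auto
    have "norm (X i - Wiener l) < r" if "i \<ge> M" for i
    proof -
      have "norm (X i - Wiener l) \<le> r / 2"
        using M[OF that] by (intro norm_wiener_leI) (simp add: lw)
      then show ?thesis using \<open>r > 0\<close> by simp
    qed
    then show "\<exists>M. \<forall>i\<ge>M. norm (X i - Wiener l) < r" by blast
  qed
  then show "convergent X" by (auto simp: convergent_def)
qed

lemma bij_shift_index: "bij (\<lambda>n::int. n - m)"
  by (rule bij_betw_byWitness[where f' = "\<lambda>n. n + m"]) auto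

lemma bij_reflect_index: "bij (\<lambda>n::int. m - n)"
  by (rule bij_betw_byWitness[where f' = "\<lambda>n. m - n"]) auto

text \<open>
  The family \<open>f m * g (n - m)\<close> of all terms of a product is summed along fixed \<open>m\<close> here, where the
  sum factorises; interchanging the order then gives the convergence of every coefficient and the
  submultiplicativity of the norm.
\<close>

lemma has_sum_product_pairs:
  assumes f: "(\<lambda>n. cmod (f n)) summable_on UNIV" and g: "(\<lambda>n. cmod (g n)) summable_on UNIV"
  shows "((\<lambda>(m, n). cmod (f m * g (n - m))) has_sum
    (\<Sum>\<^sub>\<infinity>n. cmod (f n)) * (\<Sum>\<^sub>\<infinity>n. cmod (g n))) (UNIV \<times> UNIV :: (int \<times> int) set)"
proof -
  have 1: "((\<lambda>n. cmod (f m * g (n - m))) has_sum cmod (f m) * (\<Sum>\<^sub>\<infinity>n. cmod (g n))) UNIV" for m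
  proof -
    have "((\<lambda>n. cmod (g (n - m))) has_sum (\<Sum>\<^sub>\<infinity>n. cmod (g n))) UNIV"
      using has_sum_reindex_bij_betw[OF bij_shift_index[of m], of "\<lambda>n. cmod (g n)"] g by simp
    from has_sum_cmult_right[OF this, of "cmod (f m)"] show ?thesis by (simp add: norm_mult)
  qed
  have 2: "((\<lambda>m. cmod (f m) * (\<Sum>\<^sub>\<infinity>n. cmod (g n))) has_sum
      (\<Sum>\<^sub>\<infinity>n. cmod (f n)) * (\<Sum>\<^sub>\<infinity>n. cmod (g n))) UNIV"
    by (intro has_sum_cmult_left) (simp add: f)
  have 3: "(\<lambda>(m, n). cmod (f m * g (n - m))) summable_on (UNIV \<times> UNIV)"
    by (rule summable_on_SigmaI[OF _ has_sum_imp_summable[OF 2]]) (use 1 in auto)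
  show ?thesis
    by (rule has_sum_SigmaI[OF _ 2 3]) (use 1 in auto)
qed

lemma product_pairs_summable:
  fixes f g :: fourier
  assumes "(\<lambda>n. cmod (f n)) summable_on UNIV" and "(\<lambda>n. cmod (g n)) summable_on UNIV"
  shows "(\<lambda>(n, m). cmod (f m * g (n - m))) summable_on (UNIV \<times> UNIV)"
  using has_sum_imp_summable[OF has_sum_product_pairs[OF assms]]
  by (subst summable_on_swap) (simp add: case_prod_unfold)

lemma product_abs_convergent:
  fixes f g :: fourier
  assumes "(\<lambda>n. cmod (f n)) summable_on UNIV" and "(\<lambda>n. cmod (g n)) summable_on UNIV"
  shows "(\<lambda>m. cmod (f m * g (n - m))) summable_on UNIV"
  using summable_on_SigmaD1[OF product_pairs_summable[OF assms], of n] by simp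

lemma product_abs_summable:
  fixes f g :: fourier
  assumes "(\<lambda>n. cmod (f n)) summable_on UNIV" and "(\<lambda>n. cmod (g n)) summable_on UNIV"
  shows "(\<lambda>n. cmod (product f g n)) summable_on UNIV"
    and "(\<Sum>\<^sub>\<infinity>n. cmod (product f g n)) \<le> (\<Sum>\<^sub>\<infinity>n. cmod (f n)) * (\<Sum>\<^sub>\<infinity>n. cmod (g n))"
proof -
  note pairs = product_pairs_summable[OF assms]
  have le: "cmod (product f g n) \<le> (\<Sum>\<^sub>\<infinity>m. cmod (f m * g (n - m)))" for n
    unfolding product_def by (rule norm_infsum_bound[OF product_abs_convergent[OF assms]])
  note inner = summable_on_Sigma_banach[OF pairs]
  show s: "(\<lambda>n. cmod (product f g n)) summable_on UNIV"
    by (rule summable_on_comparison_test[OF inner]) (simp_all add: le)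
  have "(\<Sum>\<^sub>\<infinity>n. cmod (product f g n)) \<le> (\<Sum>\<^sub>\<infinity>n. \<Sum>\<^sub>\<infinity>m. cmod (f m * g (n - m)))"
    by (rule infsum_mono[OF s inner le])
  also have "\<dots> = (\<Sum>\<^sub>\<infinity>m. \<Sum>\<^sub>\<infinity>n. cmod (f m * g (n - m)))"
    by (rule infsum_swap_banach[OF pairs])
  also have "\<dots> = (\<Sum>\<^sub>\<infinity>n. cmod (f n)) * (\<Sum>\<^sub>\<infinity>n. cmod (g n))"
    using infsum_Sigma'_banach[OF has_sum_imp_summable[OF has_sum_product_pairs[OF assms]]]
      infsumI[OF has_sum_product_pairs[OF assms]] by simp
  finally show "(\<Sum>\<^sub>\<infinity>n. cmod (product f g n)) \<le> (\<Sum>\<^sub>\<infinity>n. cmod (f n)) * (\<Sum>\<^sub>\<infinity>n. cmod (g n))" .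
qed

lemma product_real_valued:
  assumes "real_valued f" "real_valued g"
  shows "real_valued (product f g)"
  unfolding real_valued_def
proof
  fix n
  have "product f g (- n) = (\<Sum>\<^sub>\<infinity>m. f (- m) * g (- n - - m))"
    unfolding product_def
    using infsum_reindex_bij_betw[OF bij_reflect_index[of 0], of "\<lambda>m. f m * g (- n - m)"] by simp
  also have "\<dots> = (\<Sum>\<^sub>\<infinity>m. cnj (f m * g (n - m)))"
  proof (intro infsum_cong)
    fix m
    have "- n - - m = - (n - m)" by simp
    then show "f (- m) * g (- n - - m) = cnj (f m * g (n - m))"
      using assms by (simp only: real_valued_def complex_cnj_mult)
  qed
  finally show "product f g (- n) = cnj (product f g n)" by (simp only: product_def infsum_cnj)
qed

lift_definition conv :: "wiener \<Rightarrow> wiener \<Rightarrow> wiener" is product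
  by (simp add: product_abs_summable product_real_valued)

lemma coeff_conv: "coeff (conv v w) n = (\<Sum>\<^sub>\<infinity>m. coeff v m * coeff w (n - m))"
  by (simp add: conv.rep_eq product_def)

lemma norm_conv_le: "norm (conv v w) \<le> norm v * norm w"
  unfolding norm_wiener_def conv.rep_eq
  by (rule product_abs_summable; rule coeff_abs_summable)

lemma conv_summable: "(\<lambda>m. coeff v m * coeff w (n - m)) summable_on UNIV"
  by (rule abs_summable_summable[OF product_abs_convergent[OF coeff_abs_summable coeff_abs_summable]])

lemma bounded_bilinear_conv: "bounded_bilinear conv"
proof
  fix a a' b b' :: wiener and r :: real
  show "conv (a + a') b = conv a b + conv a' b"
    by (rule wiener_eqI) (simp add: coeff_conv distrib_right infsum_add conv_summable)
  show "conv a (b + b') = conv a b + conv a b'"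
    by (rule wiener_eqI) (simp add: coeff_conv distrib_left infsum_add conv_summable)
  show "conv (r *\<^sub>R a) b = r *\<^sub>R conv a b" "conv a (r *\<^sub>R b) = r *\<^sub>R conv a b"
    by (rule wiener_eqI, simp add: coeff_conv infsum_scaleR_right[symmetric])+
  show "\<exists>K. \<forall>a b. norm (conv a b) \<le> norm a * norm b * K"
    by (intro exI[of _ 1]) (simp add: norm_conv_le)
qed

interpretation conv: bounded_bilinear conv
  by (rule bounded_bilinear_conv)

lemma abs_phi_le_half: "\<bar>phi n\<bar> \<le> 1 / 2"
proof -
  have "0 \<le> (1 - \<bar>real_of_int n\<bar>)\<^sup>2" by simp
  then have "2 * \<bar>real_of_int n\<bar> \<le> 1 + (real_of_int n)\<^sup>2"
    by (simp add: power2_eq_square algebra_simps)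
  moreover have "\<not> 1 + (real_of_int n)\<^sup>2 < 0" by (simp add: not_less)
  ultimately show ?thesis by (auto simp: phi_def divide_simps)
qed

text \<open>
  The gain of one derivative that drives the smoothing.
\<close>

lemma abs_phi_decay: "(1 + \<bar>real_of_int n\<bar>) * \<bar>phi n\<bar> \<le> 2"
proof -
  have "0 \<le> (1 - \<bar>real_of_int n\<bar>)\<^sup>2" by simp
  then have "(1 + \<bar>real_of_int n\<bar>) * \<bar>real_of_int n\<bar> \<le> 2 * (1 + (real_of_int n)\<^sup>2)"
    by (simp add: power2_eq_square algebra_simps)
  moreover have "\<not> 1 + (real_of_int n)\<^sup>2 < 0" by (simp add: not_less)
  ultimately show ?thesis by (auto simp: phi_def divide_simps)
qed

lemma phi_uminus: "phi (- n) = - phi n"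
  by (simp add: phi_def)

text \<open>
  The operator \<open>- i \<phi>(D)\<close>; the factor \<open>- i\<close> makes it preserve real-valued functions.
\<close>

lift_definition bbm_multiplier :: "wiener \<Rightarrow> wiener" is "\<lambda>f n. - \<i> * of_real (phi n) * f n"
proof (elim CollectE conjE, intro CollectI conjI)
  fix f :: fourier
  assume f: "(\<lambda>n. cmod (f n)) summable_on UNIV" "real_valued f"
  have "cmod (- \<i> * of_real (phi n) * f n) \<le> cmod (f n)" for n
    using mult_right_mono[OF order.trans[OF abs_phi_le_half[of n], of 1], of "cmod (f n)"]
    by (simp add: norm_mult)
  then show "(\<lambda>n. cmod (- \<i> * of_real (phi n) * f n)) summable_on UNIV"
    by (intro summable_on_comparison_test[OF f(1)]) auto
  show "real_valued (\<lambda>n. - \<i> * of_real (phi n) * f n)"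
    using f(2) by (simp add: real_valued_def phi_uminus)
qed

lemma norm_bbm_multiplier_le: "norm (bbm_multiplier w) \<le> norm w / 2"
proof (rule norm_wiener_leI)
  fix A :: "int set" assume "finite A"
  have "(\<Sum>n\<in>A. cmod (coeff (bbm_multiplier w) n)) \<le> (\<Sum>n\<in>A. cmod (coeff w n) / 2)"
  proof (rule sum_mono)
    fix n
    show "cmod (coeff (bbm_multiplier w) n) \<le> cmod (coeff w n) / 2"
      using mult_right_mono[OF abs_phi_le_half[of n], of "cmod (coeff w n)"]
      by (simp add: bbm_multiplier.rep_eq norm_mult)
  qed
  also have "\<dots> \<le> norm w / 2"
    using sum_coeff_le_norm[OF \<open>finite A\<close>, of w] by (simp flip: sum_divide_distrib)
  finally show "(\<Sum>n\<in>A. cmod (coeff (bbm_multiplier w) n)) \<le> norm w / 2" .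
qed

lemma bounded_linear_bbm_multiplier: "bounded_linear bbm_multiplier"
proof (rule bounded_linear_intro[where K = "1 / 2"])
  show "bbm_multiplier (v + w) = bbm_multiplier v + bbm_multiplier w" for v w
    by (rule wiener_eqI) (simp add: bbm_multiplier.rep_eq algebra_simps)
  show "bbm_multiplier (r *\<^sub>R w) = r *\<^sub>R bbm_multiplier w" for r w
    by (rule wiener_eqI) (simp add: bbm_multiplier.rep_eq scaleR_conv_of_real)
  show "norm (bbm_multiplier w) \<le> norm w * (1 / 2)" for w
    using norm_bbm_multiplier_le[of w] by simp
qed

section \<open>Global flows of Lipschitz vector fields\<close>

lemma integral_has_vector_derivative_atLeast:
  fixes h :: "real \<Rightarrow> 'a::banach"
  assumes "continuous_on {0..} h" "t \<ge> 0"
  shows "((\<lambda>s. integral {0..s} h) has_vector_derivative h t) (at t within {0..})"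
proof -
  have "((\<lambda>s. integral {0..s} h) has_vector_derivative h t) (at t within {0..t + 1})"
    using assms by (intro integral_has_vector_derivative) (auto elim: continuous_on_subset)
  moreover have "at t within {0..} = at t within {0..t + 1}"
    by (rule at_within_nhd[where S = "{..<t + 1}"]) auto
  ultimately show ?thesis by simp
qed

lemma norm_integral_exp_le:
  fixes h :: "real \<Rightarrow> 'a::banach"
  assumes h: "continuous_on {0..s} h" and "0 \<le> s" "0 < l" "0 \<le> C"
    and le: "\<And>t. t \<in> {0..s} \<Longrightarrow> norm (h t) \<le> C * exp (l * t)"
  shows "norm (integral {0..s} h) \<le> C / l * exp (l * s)"
proof -
  have I: "((\<lambda>t. C * exp (l * t)) has_integral C / l * exp (l * s) - C / l * exp (l * 0)) {0..s}"
    using \<open>0 < l\<close> \<open>0 \<le> s\<close>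
    by (intro fundamental_theorem_of_calculus)
       (auto intro!: derivative_eq_intros simp flip: has_real_derivative_iff_has_vector_derivative)
  have "norm (integral {0..s} h) \<le> integral {0..s} (\<lambda>t. C * exp (l * t))"
    using I by (intro integral_norm_bound_integral le integrable_continuous_interval h)
      (auto intro!: continuous_intros)
  also have "\<dots> \<le> C / l * exp (l * s)"
    using integral_unique[OF I] assms(3,4) by simp
  finally show ?thesis .
qed

text \<open>
  Picard iteration on the whole half-line: in the unknown \<open>w t = exp (- l t) x t\<close> with \<open>l\<close> larger than
  the Lipschitz constant, the integral equation is a contraction on bounded continuous functions.
  The space of such functions lives on the whole real line, so negative times are clamped to 0.
\<close>

lemma lipschitz_ode_global_solution:
  fixes G :: "'a::banach \<Rightarrow> 'a"
  assumes G: "L-lipschitz_on UNIV G"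
  obtains x where "x 0 = x0"
    and "\<And>t. t \<ge> 0 \<Longrightarrow> (x has_vector_derivative G (x t)) (at t within {0..})"
proof -
  define l where "l = L + 1"
  have "L \<ge> 0" using lipschitz_on_nonneg[OF G] .
  then have l: "l > 0" by (simp add: l_def)
  have contG: "continuous_on UNIV G" by (rule lipschitz_on_continuous_on[OF G])
  have lipG: "norm (G x - G y) \<le> L * norm (x - y)" for x y
    using lipschitz_onD[OF G, of x y] by (simp add: dist_norm)
  define h where "h w t = G (exp (l * t) *\<^sub>R apply_bcontfun w t)" for w :: "real \<Rightarrow>\<^sub>C 'a" and t
  have conth: "continuous_on S (h w)" for S w
    unfolding h_def by (rule continuous_on_compose2[OF contG]) (auto intro!: continuous_intros)
  define E where "E w s = exp (- l * s) *\<^sub>R (x0 + integral {0..s} (h w))" for w s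
  define F where "F w = Bcontfun (\<lambda>t. E w (max 0 t))" for w
  have hbound: "norm (h w t) \<le> (norm (G 0) + L * norm w) * exp (l * t)" if "t \<ge> 0" for w t
  proof -
    have "norm (h w t) \<le> norm (G 0) + norm (G (exp (l * t) *\<^sub>R apply_bcontfun w t) - G 0)"
      unfolding h_def by norm
    also have "\<dots> \<le> norm (G 0) * 1 + L * (exp (l * t) * norm w)"
      using order.trans[OF lipG[of "exp (l * t) *\<^sub>R apply_bcontfun w t" 0]
          mult_left_mono[OF _ \<open>L \<ge> 0\<close>, of _ "exp (l * t) * norm w"]] norm_bounded[of w t]
      by simp
    also have "\<dots> \<le> norm (G 0) * exp (l * t) + L * (exp (l * t) * norm w)"
      using that l by (intro add_right_mono mult_left_mono) auto
    finally show ?thesis by (simp add: algebra_simps)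
  qed
  have Ebound: "norm (E w s) \<le> norm x0 + (norm (G 0) + L * norm w) / l" if "s \<ge> 0" for w s
  proof -
    have "norm (integral {0..s} (h w)) \<le> (norm (G 0) + L * norm w) / l * exp (l * s)"
      using that l \<open>L \<ge> 0\<close> hbound conth by (intro norm_integral_exp_le) auto
    then have "exp (- l * s) * norm (integral {0..s} (h w)) \<le> (norm (G 0) + L * norm w) / l"
      by (simp add: exp_minus field_simps)
    moreover have "exp (- l * s) * norm x0 \<le> norm x0"
      using that l by (intro mult_left_le_one_le) auto
    moreover have "norm (E w s) \<le> exp (- l * s) * (norm x0 + norm (integral {0..s} (h w)))"
      unfolding E_def norm_scaleR by (simp add: norm_triangle_ineq)
    ultimately show ?thesis by (simp add: distrib_left)
  qed
  have contE: "continuous_on {0..} (E w)" for w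
    unfolding E_def
    by (intro continuous_intros
        continuous_on_vector_derivative[OF integral_has_vector_derivative_atLeast[OF conth]]) auto
  have F: "apply_bcontfun (F w) t = E w (max 0 t)" for w t
  proof -
    have "(\<lambda>t. E w (max 0 t)) \<in> bcontfun"
    proof (rule bcontfun_normI)
      show "continuous_on UNIV (\<lambda>t. E w (max 0 t))"
        by (rule continuous_on_compose2[OF contE]) (auto intro!: continuous_intros)
    qed (rule Ebound, simp)
    then show ?thesis by (simp add: F_def Bcontfun_inverse)
  qed
  have contr: "dist (F v) (F w) \<le> (L / l) * dist v w" for v w
  proof (rule dist_bound)
    fix t :: real
    define s where "s = max 0 t"
    have "norm (h v r - h w r) \<le> L * dist v w * exp (l * r)" for r
    proof -
      have "norm (h v r - h w r)
        \<le> L * norm (exp (l * r) *\<^sub>R apply_bcontfun v r - exp (l * r) *\<^sub>R apply_bcontfun w r)"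
        unfolding h_def by (rule lipG)
      also have "\<dots> = L * (exp (l * r) * dist (apply_bcontfun v r) (apply_bcontfun w r))"
        by (simp add: dist_norm flip: scaleR_diff_right)
      also have "\<dots> \<le> L * (exp (l * r) * dist v w)"
        using \<open>L \<ge> 0\<close> by (intro mult_left_mono dist_bounded) auto
      finally show ?thesis by (simp add: mult_ac)
    qed
    then have "norm (integral {0..s} (\<lambda>r. h v r - h w r)) \<le> L * dist v w / l * exp (l * s)"
      using \<open>L \<ge> 0\<close> l by (intro norm_integral_exp_le continuous_on_diff conth) (auto simp: s_def)
    moreover have "integral {0..s} (\<lambda>r. h v r - h w r) = integral {0..s} (h v) - integral {0..s} (h w)"
      by (intro integral_diff integrable_continuous_interval conth)
    moreover have "E v s - E w s = exp (- l * s) *\<^sub>R (integral {0..s} (h v) - integral {0..s} (h w))"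
      by (simp add: E_def flip: scaleR_diff_right)
    ultimately have "norm (E v s - E w s) \<le> exp (- l * s) * (L * dist v w / l * exp (l * s))"
      by (simp only: norm_scaleR abs_exp_cancel mult_left_mono exp_ge_zero)
    also have "\<dots> = (L / l) * dist v w" by (simp add: exp_minus field_simps)
    finally show "dist (apply_bcontfun (F v) t) (apply_bcontfun (F w) t) \<le> (L / l) * dist v w"
      by (simp add: F dist_norm s_def)
  qed
  have "\<exists>!w. F w = w"
    using contr l \<open>L \<ge> 0\<close> by (intro banach_fix_type[of "L / l"]) (auto simp: l_def)
  then obtain w where w: "F w = w" by blast
  define x where "x t = x0 + integral {0..t} (h w)" for t
  have xw: "exp (l * t) *\<^sub>R apply_bcontfun w t = x t" if "t \<ge> 0" for t
  proof -
    have "apply_bcontfun w t = exp (- l * t) *\<^sub>R x t"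
      using F[of w t] that by (simp add: w E_def x_def)
    then show ?thesis by (simp flip: exp_add)
  qed
  have "(x has_vector_derivative G (x t)) (at t within {0..})" if "t \<ge> 0" for t
  proof -
    have "(x has_vector_derivative h w t) (at t within {0..})"
      using has_vector_derivative_add[OF has_vector_derivative_const[of x0]
          integral_has_vector_derivative_atLeast[OF conth[of _ w] that]]
      by (simp add: x_def[abs_def])
    then show ?thesis using that by (simp add: h_def xw)
  qed
  moreover have "x 0 = x0" by (simp add: x_def)
  ultimately show ?thesis using that by blast
qed

section \<open>The equation with damped nonlinearity\<close>

text \<open>
  Multiplication of \<open>x\<close> by this factor is the radial retraction onto the ball of radius \<open>R\<close>.
\<close>

definition radial_cutoff :: "real \<Rightarrow> 'a::real_normed_vector \<Rightarrow> real"
  where "radial_cutoff R x = R / max R (norm x)"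

lemma radial_cutoff_bounds:
  assumes "R > 0"
  shows "0 \<le> radial_cutoff R x" "radial_cutoff R x \<le> 1" "norm (radial_cutoff R x *\<^sub>R x) \<le> R"
  using assms by (auto simp: radial_cutoff_def divide_simps max_def)

lemma radial_cutoff_eq_1: "R > 0 \<Longrightarrow> norm x \<le> R \<Longrightarrow> radial_cutoff R x = 1"
  by (simp add: radial_cutoff_def)

text \<open>
  Split the difference into the change of \<open>x\<close> and the change of the factor; each part is at most
  \<open>norm (x - y)\<close>.
\<close>

lemma radial_retraction_lipschitz:
  assumes "R > 0"
  shows "norm (radial_cutoff R x *\<^sub>R x - radial_cutoff R y *\<^sub>R y) \<le> 2 * norm (x - y)"
proof -
  define a where "a = max R (norm x)"
  define b where "b = max R (norm y)"
  have ab: "a > 0" "b > 0" "norm y \<le> b" "R \<le> a" using assms by (auto simp: a_def b_def)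
  have "\<bar>b - a\<bar> \<le> norm (x - y)" 
    using norm_triangle_ineq3[of x y] by (auto simp: a_def b_def max_def)
  moreover have "R / a * (norm y / b) \<le> 1 * 1"
    using ab assms by (intro mult_mono) (auto simp: divide_simps)
  ultimately have "R / a * (norm y / b) * \<bar>b - a\<bar> \<le> 1 * norm (x - y)"
    by (intro mult_mono) auto
  moreover have "norm ((R / a - R / b) *\<^sub>R y) = R / a * (norm y / b) * \<bar>b - a\<bar>"
    using ab assms by (simp add: abs_mult abs_divide diff_frac_eq right_diff_distrib[symmetric])
  ultimately have 2: "norm ((R / a - R / b) *\<^sub>R y) \<le> norm (x - y)" by simp
  have 1: "norm ((R / a) *\<^sub>R (x - y)) \<le> norm (x - y)"
    using ab assms by (auto simp: divide_simps mult.commute[of _ a] intro!: mult_right_mono)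
  have "(R / a) *\<^sub>R x - (R / b) *\<^sub>R y = (R / a) *\<^sub>R (x - y) + (R / a - R / b) *\<^sub>R y"
    by (simp add: algebra_simps)
  then have "norm ((R / a) *\<^sub>R x - (R / b) *\<^sub>R y) \<le> norm (x - y) + norm (x - y)"
    using norm_triangle_mono[OF 1 2] by simp
  then show ?thesis by (simp add: radial_cutoff_def a_def b_def)
qed

text \<open>
  The right-hand side \<open>- i \<phi>(D) (w + c w\<^sup>2 / 2)\<close>, with a scalar \<open>c\<close> that damps the
  nonlinearity; \<open>c = 1\<close> is the BBM equation.
\<close>

definition bbm_field :: "real \<Rightarrow> wiener \<Rightarrow> wiener"
  where "bbm_field c w = bbm_multiplier (w + (c / 2) *\<^sub>R conv w w)"

lemma conv_diff_square: "conv v v - conv w w = conv (v - w) v + conv w (v - w)"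
  by (simp add: conv.diff_left conv.diff_right)

text \<open>
  The square of the factor distributes over the two arguments of the product, so that the damped
  square is the square of the retraction of \<open>w\<close>, which is bounded and Lipschitz.
\<close>

lemma cutoff_bbm_field_lipschitz:
  assumes R: "R > 0"
  shows "(1 + 2 * R)-lipschitz_on UNIV (\<lambda>w. bbm_field ((radial_cutoff R w)\<^sup>2) w)"
proof (rule lipschitz_onI)
  fix v w :: wiener
  define p where "p u = radial_cutoff R u *\<^sub>R u" for u :: wiener
  have p: "norm (p u) \<le> R" for u unfolding p_def using radial_cutoff_bounds[OF R] by simp
  have field: "bbm_field ((radial_cutoff R u)\<^sup>2) u = bbm_multiplier (u + (1 / 2) *\<^sub>R conv (p u) (p u))" for u
    by (simp add: bbm_field_def p_def conv.scaleR_left conv.scaleR_right power2_eq_square)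
  have "norm (conv (p v) (p v) - conv (p w) (p w))
    \<le> norm (p v - p w) * norm (p v) + norm (p w) * norm (p v - p w)"
    unfolding conv_diff_square by (intro norm_triangle_mono norm_conv_le)
  also have "\<dots> \<le> (2 * norm (v - w)) * R + R * (2 * norm (v - w))"
    using radial_retraction_lipschitz[OF R, of v w] R
    by (intro add_mono mult_mono) (auto simp: p p_def[symmetric])
  finally have sq: "norm (conv (p v) (p v) - conv (p w) (p w)) \<le> 4 * R * norm (v - w)" by simp
  have "dist (bbm_field ((radial_cutoff R v)\<^sup>2) v) (bbm_field ((radial_cutoff R w)\<^sup>2) w)
    = norm (bbm_multiplier ((v - w) + (1 / 2) *\<^sub>R (conv (p v) (p v) - conv (p w) (p w))))"
    unfolding field dist_norm 
      linear_diff[OF bounded_linear.linear[OF bounded_linear_bbm_multiplier], symmetric]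
    by (simp add: algebra_simps)
  also have "\<dots> \<le> norm ((v - w) + (1 / 2) *\<^sub>R (conv (p v) (p v) - conv (p w) (p w)))"
    by (rule order.trans[OF norm_bbm_multiplier_le]) simp
  also have "\<dots> \<le> norm (v - w) + 2 * R * norm (v - w)"
    using sq by (intro norm_triangle_mono) auto
  finally show "dist (bbm_field ((radial_cutoff R v)\<^sup>2) v) (bbm_field ((radial_cutoff R w)\<^sup>2) w)
    \<le> (1 + 2 * R) * dist v w"
    by (simp add: dist_norm algebra_simps)
qed (use R in simp)

text \<open>
  The damping may be any function of time: the estimates below only need it to stay between 0 and 1.
\<close>

definition bbm_flow :: "(real \<Rightarrow> real) \<Rightarrow> (real \<Rightarrow> wiener) \<Rightarrow> bool"
  where "bbm_flow c x \<longleftrightarrow> (\<forall>t\<ge>0. 0 \<le> c t \<and> c t \<le> 1 \<and>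
    (x has_vector_derivative bbm_field (c t) (x t)) (at t within {0..}))"

lemma coeff_bbm_field:
  "coeff (bbm_field c w) n = - \<i> * of_real (phi n) * (coeff w n + of_real (c / 2) * coeff (conv w w) n)"
  by (simp add: bbm_field_def bbm_multiplier.rep_eq scaleR_conv_of_real)

lemma increment_le:
  fixes f :: "real \<Rightarrow> 'a::real_normed_vector"
  assumes f: "\<And>t. t \<ge> 0 \<Longrightarrow> (f has_vector_derivative f' t) (at t within {0..})"
    and ab: "0 \<le> a" "a \<le> b"
    and K: "\<And>t. a < t \<Longrightarrow> t < b \<Longrightarrow> norm (f' t) \<le> K"
  shows "norm (f b - f a) \<le> K * (b - a)"
proof (cases "a = b")
  case False
  have "norm (f b - f a) \<le> K * b - K * a"
  proof (rule differentiable_bound_general[where f' = f' and \<phi>' = "\<lambda>_. K"])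
    show "continuous_on {a..b} f"
      by (rule continuous_on_subset[OF continuous_on_vector_derivative[OF f]]) (use ab in auto)
    show "(f has_vector_derivative f' t) (at t)" if "a < t" "t < b" for t
      using f[of t] that ab by (simp add: at_within_interior[of t "{0..}"])
    show "((\<lambda>t. K * t) has_vector_derivative K) (at t)" for t
      by (auto intro!: derivative_eq_intros simp flip: has_real_derivative_iff_has_vector_derivative)
  qed (use False ab K in \<open>auto intro!: continuous_intros\<close>)
  then show ?thesis by (simp add: algebra_simps)
qed simp

context
  fixes c x
  assumes flow: "bbm_flow c x"
begin

lemma flow_deriv: "t \<ge> 0 \<Longrightarrow> (x has_vector_derivative bbm_field (c t) (x t)) (at t within {0..})"
  and flow_cutoff_range: "t \<ge> 0 \<Longrightarrow> 0 \<le> c t" "t \<ge> 0 \<Longrightarrow> c t \<le> 1"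
  using flow by (auto simp: bbm_flow_def)

lemma flow_coeff_deriv:
  "t \<ge> 0 \<Longrightarrow> ((\<lambda>s. coeff (x s) n) has_vector_derivative coeff (bbm_field (c t) (x t)) n) (at t within {0..})"
  by (rule bounded_linear.has_vector_derivative[OF bounded_linear_coeff flow_deriv])

lemma flow_continuous: "continuous_on {0..} x"
  by (rule continuous_on_vector_derivative[OF flow_deriv]) auto

lemma flow_bounded: "\<exists>B\<ge>0. \<forall>t\<in>{0..T}. norm (x t) \<le> B"
proof -
  have "bounded (x ` {0..T})"
    by (intro compact_imp_bounded compact_continuous_image continuous_on_subset[OF flow_continuous]) auto
  then obtain B where "\<forall>t\<in>{0..T}. norm (x t) \<le> B" by (auto simp: bounded_iff)
  then show ?thesis by (intro exI[of _ "max 0 B"]) auto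
qed

end

section \<open>Smoothing\<close>

definition rapid_decay :: "fourier \<Rightarrow> bool"
  where "rapid_decay f \<longleftrightarrow> (\<forall>k. \<exists>C. \<forall>n. (1 + \<bar>real_of_int n\<bar>) ^ k * cmod (f n) \<le> C)"

lemma power_add_le:
  fixes a b :: real
  assumes "0 \<le> a" "0 \<le> b"
  shows "(a + b) ^ k \<le> 2 ^ k * (a ^ k + b ^ k)"
proof -
  have "(a + b) ^ k \<le> (2 * max a b) ^ k" using assms by (intro power_mono) auto
  also have "\<dots> = 2 ^ k * (max a b) ^ k" by (simp add: power_mult_distrib)
  also have "\<dots> \<le> 2 ^ k * (a ^ k + b ^ k)"
    using assms by (intro mult_left_mono) (auto simp: max_def)
  finally show ?thesis .
qed

text \<open>
  The product of two sequences decays like the factors, because one of the frequencies \<open>m\<close> and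
  \<open>n - m\<close> is at least half as large as \<open>n\<close> and the other factor is summable.
\<close>

lemma conv_decay:
  assumes w: "\<And>n. (1 + \<bar>real_of_int n\<bar>) ^ k * cmod (coeff w n) \<le> C"
  shows "(1 + \<bar>real_of_int n\<bar>) ^ k * cmod (coeff (conv w w) n) \<le> 2 ^ k * C * (2 * norm w)"
proof -
  define W where "W n = (1 + \<bar>real_of_int n\<bar>) ^ k" for n
  have W: "W n > 0" for n by (simp add: W_def add_pos_nonneg)
  have sub: "W n \<le> 2 ^ k * (W m + W (n - m))" for m
  proof -
    have "W n \<le> ((1 + \<bar>real_of_int m\<bar>) + (1 + \<bar>real_of_int (n - m)\<bar>)) ^ k"
      unfolding W_def by (intro power_mono) auto
    also have "\<dots> \<le> 2 ^ k * (W m + W (n - m))" unfolding W_def by (rule power_add_le) auto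
    finally show ?thesis .
  qed
  have 1: "((\<lambda>m. of_real (W n) * (coeff w m * coeff w (n - m))) has_sum
      of_real (W n) * coeff (conv w w) n) UNIV"
    unfolding coeff_conv by (intro has_sum_cmult_right has_sum_infsum conv_summable)
  have s: "((\<lambda>m. cmod (coeff w m)) has_sum norm w) UNIV"
    unfolding norm_wiener_def by (intro has_sum_infsum coeff_abs_summable)
  have r: "((\<lambda>m. cmod (coeff w (n - m))) has_sum norm w) UNIV"
    using s has_sum_reindex_bij_betw[OF bij_reflect_index[of n], of "\<lambda>m. cmod (coeff w m)"] by simp
  have 2: "((\<lambda>m. 2 ^ k * C * (cmod (coeff w m) + cmod (coeff w (n - m)))) has_sum
      2 ^ k * C * (norm w + norm w)) UNIV"
    by (intro has_sum_cmult_right has_sum_add r s)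
  have "norm (of_real (W n) * coeff (conv w w) n) \<le> 2 ^ k * C * (norm w + norm w)"
  proof (rule norm_infsum_le[OF 1 2])
    fix m
    have "norm (of_real (W n) * (coeff w m * coeff w (n - m)))
      = W n * (cmod (coeff w m) * cmod (coeff w (n - m)))"
      using W[of n] by (simp add: norm_mult)
    also have "\<dots> \<le> 2 ^ k * (W m + W (n - m)) * (cmod (coeff w m) * cmod (coeff w (n - m)))"
      by (intro mult_right_mono sub) auto
    also have "\<dots> = 2 ^ k * ((W m * cmod (coeff w m)) * cmod (coeff w (n - m))
        + (W (n - m) * cmod (coeff w (n - m))) * cmod (coeff w m))"
      by (simp add: algebra_simps)
    also have "\<dots> \<le> 2 ^ k * (C * cmod (coeff w (n - m)) + C * cmod (coeff w m))"
      using w[of m] w[of "n - m"] unfolding W_def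
      by (intro mult_left_mono add_mono mult_right_mono) (simp_all del: of_int_diff)
    finally show "norm (of_real (W n) * (coeff w m * coeff w (n - m)))
      \<le> 2 ^ k * C * (cmod (coeff w m) + cmod (coeff w (n - m)))"
      by (simp add: algebra_simps)
  qed
  moreover have "norm (of_real (W n) * coeff (conv w w) n) = W n * cmod (coeff (conv w w) n)"
    using W[of n] by (simp add: norm_mult)
  ultimately show ?thesis by (simp only: W_def mult_2)
qed

lemma coeff_bbm_field_decay:
  assumes w: "\<And>n. (1 + \<bar>real_of_int n\<bar>) ^ k * cmod (coeff w n) \<le> C"
    and c: "0 \<le> c" "c \<le> 1"
  shows "(1 + \<bar>real_of_int n\<bar>) ^ Suc k * cmod (coeff (bbm_field c w) n) \<le> 2 * (C + 2 ^ k * C * norm w)"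
proof -
  let ?W = "1 + \<bar>real_of_int n\<bar>"
  have "cmod (coeff w n + of_real (c / 2) * coeff (conv w w) n)
    \<le> cmod (coeff w n) + (1 / 2) * cmod (coeff (conv w w) n)"
  proof -
    have "cmod (of_real (c / 2) * coeff (conv w w) n) \<le> (1 / 2) * cmod (coeff (conv w w) n)"
      using c unfolding norm_mult by (intro mult_right_mono) auto
    then show ?thesis using norm_triangle_mono by blast
  qed
  then have "?W ^ k * cmod (coeff w n + of_real (c / 2) * coeff (conv w w) n)
    \<le> ?W ^ k * (cmod (coeff w n) + (1 / 2) * cmod (coeff (conv w w) n))"
    by (intro mult_left_mono) auto
  also have "\<dots> = ?W ^ k * cmod (coeff w n) + (1 / 2) * (?W ^ k * cmod (coeff (conv w w) n))"
    by (simp add: algebra_simps)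
  also have "\<dots> \<le> C + (1 / 2) * (2 ^ k * C * (2 * norm w))"
    by (intro add_mono mult_left_mono conv_decay w) auto
  finally have 1: "?W ^ k * cmod (coeff w n + of_real (c / 2) * coeff (conv w w) n)
    \<le> C + 2 ^ k * C * norm w" by simp
  have "?W ^ Suc k * cmod (coeff (bbm_field c w) n)
    = (?W * \<bar>phi n\<bar>) * (?W ^ k * cmod (coeff w n + of_real (c / 2) * coeff (conv w w) n))"
    by (simp add: coeff_bbm_field norm_mult)
  also have "\<dots> \<le> 2 * (C + 2 ^ k * C * norm w)"
    using 1 by (intro mult_mono abs_phi_decay) auto
  finally show ?thesis .
qed

text \<open>
  If the coefficients decay like the power \<open>k\<close>, then so does their nonlinear forcing, and the
  multiplier makes it decay like the power \<open>k + 1\<close>.  Hence the increments of the coefficients decay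
  one power faster than the coefficients are known to; this gives regularity by induction, and also
  continuity in time in every Sobolev space.
\<close>

lemma flow_coeff_lipschitz:
  assumes flow: "bbm_flow c x"
    and C: "\<And>t n. t \<in> {0..T} \<Longrightarrow> (1 + \<bar>real_of_int n\<bar>) ^ k * cmod (coeff (x t) n) \<le> C"
  shows "\<exists>K. \<forall>a b n. 0 \<le> a \<longrightarrow> a \<le> b \<longrightarrow> b \<le> T \<longrightarrow>
    (1 + \<bar>real_of_int n\<bar>) ^ Suc k * cmod (coeff (x b) n - coeff (x a) n) \<le> K * (b - a)"
proof -
  obtain B where B: "B \<ge> 0" "\<And>t. t \<in> {0..T} \<Longrightarrow> norm (x t) \<le> B" using flow_bounded[OF flow, of T] by blast
  define K where "K = 2 * (C + 2 ^ k * C * B)"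
  have "(1 + \<bar>real_of_int n\<bar>) ^ Suc k * cmod (coeff (x b) n - coeff (x a) n) \<le> K * (b - a)"
    if ab: "0 \<le> a" "a \<le> b" "b \<le> T" for a b n
  proof -
    let ?W = "(1 + \<bar>real_of_int n\<bar>) ^ Suc k"
    have W: "?W > 0" by (intro zero_less_power) auto
    have "0 \<le> (1 + \<bar>real_of_int n\<bar>) ^ k * cmod (coeff (x a) n)" by simp
    also have "\<dots> \<le> C" using ab by (intro C) auto
    finally have "C \<ge> 0" .
    have K: "?W * cmod (coeff (bbm_field (c s) (x s)) n) \<le> K" if "s \<in> {0..T}" for s
    proof -
      have "?W * cmod (coeff (bbm_field (c s) (x s)) n) \<le> 2 * (C + 2 ^ k * C * norm (x s))"
        by (rule coeff_bbm_field_decay[OF C[OF that]]) (use flow_cutoff_range[OF flow] that in auto)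
      also have "\<dots> \<le> K"
        unfolding K_def using B(2)[OF that] \<open>C \<ge> 0\<close>
        by (intro mult_left_mono add_left_mono) auto
      finally show ?thesis .
    qed
    have "norm (coeff (x b) n - coeff (x a) n) \<le> K / ?W * (b - a)"
    proof (rule increment_le[OF flow_coeff_deriv[OF flow]])
      fix s assume "a < s" "s < b"
      then show "norm (coeff (bbm_field (c s) (x s)) n) \<le> K / ?W"
        using K[of s] ab W by (simp add: pos_le_divide_eq mult.commute)
    qed (use ab in auto)
    then show ?thesis using W by (simp add: field_simps)
  qed
  then show ?thesis by blast
qed

lemma flow_decay:
  assumes flow: "bbm_flow c x" and x0: "rapid_decay (coeff (x 0))"
  shows "\<exists>C. \<forall>t\<in>{0..T}. \<forall>n. (1 + \<bar>real_of_int n\<bar>) ^ k * cmod (coeff (x t) n) \<le> C"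
proof (induction k)
  case 0
  obtain B where "\<forall>t\<in>{0..T}. norm (x t) \<le> B" using flow_bounded[OF flow] by blast
  then show ?case by (intro exI[of _ B]) (auto intro: order.trans[OF coeff_le_norm])
next
  case (Suc k)
  then obtain C where "\<And>t n. t \<in> {0..T} \<Longrightarrow> (1 + \<bar>real_of_int n\<bar>) ^ k * cmod (coeff (x t) n) \<le> C"
    by blast
  from flow_coeff_lipschitz[OF flow this] obtain K where K: "\<And>a b n. 0 \<le> a \<Longrightarrow> a \<le> b \<Longrightarrow> b \<le> T \<Longrightarrow>
      (1 + \<bar>real_of_int n\<bar>) ^ Suc k * cmod (coeff (x b) n - coeff (x a) n) \<le> K * (b - a)"
    by metis
  obtain D where D: "\<And>n. (1 + \<bar>real_of_int n\<bar>) ^ Suc k * cmod (coeff (x 0) n) \<le> D"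
    using x0 unfolding rapid_decay_def by blast
  have "(1 + \<bar>real_of_int n\<bar>) ^ Suc k * cmod (coeff (x t) n) \<le> D + \<bar>K\<bar> * T" if t: "t \<in> {0..T}" for t n
  proof -
    let ?W = "(1 + \<bar>real_of_int n\<bar>) ^ Suc k"
    have W: "?W > 0" by (intro zero_less_power) auto
    have "?W * norm (coeff (x t) n - coeff (x 0) n) \<le> K * t"
      using K[of 0 t n] t by simp
    also have "\<dots> \<le> \<bar>K\<bar> * T" using t by (intro mult_mono) auto
    finally have 1: "?W * norm (coeff (x t) n - coeff (x 0) n) \<le> \<bar>K\<bar> * T" .
    have "?W * cmod (coeff (x t) n) \<le> ?W * (cmod (coeff (x 0) n) + norm (coeff (x t) n - coeff (x 0) n))"
      using W norm_triangle_sub[of "coeff (x t) n" "coeff (x 0) n"] by (intro mult_left_mono) auto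
    also have "\<dots> \<le> D + \<bar>K\<bar> * T"
      using 1 D[of n] by (simp only: distrib_left add_mono)
    finally show ?thesis .
  qed
  then show ?case by blast
qed

section \<open>Conservation of energy\<close>

lemma inverse_square_summable: "(\<lambda>n::int. 1 / (1 + \<bar>real_of_int n\<bar>)\<^sup>2) summable_on UNIV"
proof -
  have nat: "(\<lambda>k::nat. 1 / (1 + real k)\<^sup>2) summable_on UNIV"
  proof (rule summable_nonneg_imp_summable_on)
    show "summable (\<lambda>k. 1 / (1 + real k)\<^sup>2)"
      using summable_ignore_initial_segment[OF inverse_power_summable[of 2, where 'a = real], of 1]
      by (simp add: inverse_eq_divide add.commute)
  qed auto
  have "(\<lambda>n. 1 / (1 + \<bar>real_of_int n\<bar>)\<^sup>2) summable_on range int"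
    using nat by (subst summable_on_reindex) (auto simp: o_def)
  moreover have "(\<lambda>n. 1 / (1 + \<bar>real_of_int n\<bar>)\<^sup>2) summable_on range (\<lambda>k. - int k)"
    using nat by (subst summable_on_reindex) (auto simp: o_def inj_on_def)
  ultimately have "(\<lambda>n. 1 / (1 + \<bar>real_of_int n\<bar>)\<^sup>2) summable_on (range int \<union> range (\<lambda>k. - int k))"
    by (rule summable_on_union)
  moreover have "range int \<union> range (\<lambda>k. - int k) = UNIV"
  proof -
    have "n \<in> range int \<union> range (\<lambda>k. - int k)" for n
      by (cases n rule: int_cases2) auto
    then show ?thesis by blast
  qed
  ultimately show ?thesis by simp
qed

text \<open>
  This is \<open>\<integral> u \<partial>\<^sub>x(u\<^sup>2) = 0\<close>, the identity behind the conservation of energy.  Written over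
  frequencies \<open>a + b + c = 0\<close>, the sums of \<open>a u\<^sub>a u\<^sub>b u\<^sub>c\<close>, \<open>b u\<^sub>a u\<^sub>b u\<^sub>c\<close> and \<open>c u\<^sub>a u\<^sub>b u\<^sub>c\<close>
  coincide by symmetry and add up to zero.
\<close>

lemma trilinear_cancellation:
  assumes w: "(\<lambda>n. \<bar>real_of_int n\<bar> * cmod (coeff w n)) summable_on UNIV"
  shows "((\<lambda>n. of_int n * cnj (coeff w n) * coeff (conv w w) n) has_sum 0) UNIV"
proof -
  define F where "F = (\<lambda>(n, m). (of_int m * coeff w m) * coeff w (n - m) * coeff w (- n))"
  define G where "G = (\<lambda>(n, m). of_int n * (coeff w m * coeff w (n - m)) * coeff w (- n))"
  have "(\<lambda>(n, m). cmod ((of_int m * coeff w m) * coeff w (n - m))) summable_on (UNIV \<times> UNIV)"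
    using w by (intro product_pairs_summable[of "\<lambda>m. of_int m * coeff w m"])
      (simp_all add: norm_mult coeff_abs_summable)
  then have "(\<lambda>p. (case p of (n, m) \<Rightarrow> cmod (of_int m * coeff w m * coeff w (n - m))) * norm w)
      summable_on UNIV"
    by (intro summable_on_cmult_left) simp
  then have "(\<lambda>p. norm (F p)) summable_on UNIV"
  proof (rule summable_on_comparison_test)
    fix p :: "int \<times> int"
    show "norm (F p) \<le> (case p of (n, m) \<Rightarrow> cmod (of_int m * coeff w m * coeff w (n - m))) * norm w"
      by (cases p) (auto simp: F_def norm_mult intro!: mult_left_mono coeff_le_norm)
  qed auto
  then have F: "F summable_on UNIV" by (rule abs_summable_summable)
  define S where "S = infsum F UNIV"
  have FS: "(F has_sum S) UNIV" unfolding S_def using F by simp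
  \<comment> \<open>The three frequencies \<open>m\<close>, \<open>n - m\<close> and \<open>- n\<close> add up to zero and enter symmetrically.\<close>
  have "bij (\<lambda>(n, m). (n, n - m) :: int \<times> int)"
    by (rule bij_betw_byWitness[where f' = "\<lambda>(n, m). (n, n - m)"]) auto
  from has_sum_reindex_bij_betw[OF this, of F S] FS
  have 1: "((\<lambda>p. F ((\<lambda>(n, m). (n, n - m)) p)) has_sum S) UNIV" by simp
  have "bij (\<lambda>(n, m). (- m, - n) :: int \<times> int)"
    by (rule bij_betw_byWitness[where f' = "\<lambda>(n, m). (- m, - n)"]) auto
  from has_sum_reindex_bij_betw[OF this, of F S] FS
  have 2: "((\<lambda>p. F ((\<lambda>(n, m). (- m, - n)) p)) has_sum S) UNIV" by simp
  have "F p + F ((\<lambda>(n, m). (n, n - m)) p) = G p" for p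
    by (cases p) (simp add: F_def G_def ring_distribs mult_ac)
  with has_sum_add[OF FS 1] have G1: "(G has_sum (S + S)) UNIV" by simp
  have "- F ((\<lambda>(n, m). (- m, - n)) p) = G p" for p
    by (cases p) (simp add: F_def G_def mult_ac)
  with has_sum_uminusI[OF 2] have "(G has_sum (- S)) UNIV" by simp
  with G1 have "S + S = - S" by (rule has_sum_unique)
  moreover have "3 * S = (S + S) + S" by simp
  ultimately have "3 * S = 0" by (simp only: left_minus)
  with G1 have G: "(G has_sum 0) (UNIV \<times> UNIV)" by simp
  have "((\<lambda>m. G (n, m)) has_sum (of_int n * cnj (coeff w n) * coeff (conv w w) n)) UNIV" for n
  proof -
    have "((\<lambda>m. of_int n * coeff w (- n) * (coeff w m * coeff w (n - m))) has_sum
        of_int n * coeff w (- n) * coeff (conv w w) n) UNIV"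
      unfolding coeff_conv by (intro has_sum_cmult_right has_sum_infsum conv_summable)
    then show ?thesis by (simp add: G_def coeff_uminus_index mult_ac)
  qed
  then show ?thesis by (intro has_sum_SigmaD[OF G]) auto
qed

text \<open>
  The part of the square of the \<open>H\<^sup>1\<close> norm that lies in frequencies up to \<open>K\<close>.
\<close>

definition energy :: "nat \<Rightarrow> wiener \<Rightarrow> real"
  where "energy K w = (\<Sum>n\<in>{- int K..int K}. (1 + (real_of_int n)\<^sup>2) * (cmod (coeff w n))\<^sup>2)"

lemma energy_mono: "K \<le> K' \<Longrightarrow> energy K w \<le> energy K' w"
  unfolding energy_def by (intro sum_mono2) auto

text \<open>
  The rate at which the nonlinearity carries energy into the frequencies up to \<open>K\<close>.
\<close>

definition energy_flux :: "nat \<Rightarrow> wiener \<Rightarrow> real"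
  where "energy_flux K w = Im (\<Sum>n\<in>{- int K..int K}. of_int n * cnj (coeff w n) * coeff (conv w w) n)"

lemma energy_deriv:
  assumes "bbm_flow c x" "t \<ge> 0"
  shows "((\<lambda>s. energy K (x s)) has_vector_derivative c t * energy_flux K (x t)) (at t within {0..})"
proof -
  have 1: "((\<lambda>s. (cmod (coeff (x s) n))\<^sup>2) has_vector_derivative
      2 * (coeff (x t) n \<bullet> coeff (bbm_field (c t) (x t)) n)) (at t within {0..})" for n
    unfolding power2_norm_eq_inner
    using bounded_bilinear.has_vector_derivative[OF bounded_bilinear_inner
        flow_coeff_deriv[OF assms, of n] flow_coeff_deriv[OF assms, of n]]
    by (simp add: inner_commute)
  have 2: "(1 + (real_of_int n)\<^sup>2) * (2 * (coeff w n \<bullet> coeff (bbm_field r w) n))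
      = r * Im (of_int n * cnj (coeff w n) * coeff (conv w w) n)" for n r w
  proof -
    have "coeff w n \<bullet> coeff (bbm_field r w) n
      = phi n * (r / 2) * Im (cnj (coeff w n) * coeff (conv w w) n)"
      by (simp add: coeff_bbm_field inner_complex_def algebra_simps)
    moreover have "(1 + (real_of_int n)\<^sup>2) * phi n = real_of_int n"
    proof -
      have "1 + (real_of_int n)\<^sup>2 \<noteq> 0" using zero_le_power2[of "real_of_int n"] by linarith
      then show ?thesis by (simp add: phi_def)
    qed
    moreover have "p * (2 * (f * (r / 2) * i)) = r * ((p * f) * i)" for p f i :: real
      by simp
    ultimately have "(1 + (real_of_int n)\<^sup>2) * (2 * (coeff w n \<bullet> coeff (bbm_field r w) n))
      = r * (real_of_int n * Im (cnj (coeff w n) * coeff (conv w w) n))"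
      by (simp only:)
    moreover have "Im (of_int n * cnj (coeff w n) * coeff (conv w w) n)
      = real_of_int n * Im (cnj (coeff w n) * coeff (conv w w) n)"
      by (simp add: algebra_simps)
    ultimately show ?thesis by simp
  qed
  have "((\<lambda>s. energy K (x s)) has_vector_derivative (\<Sum>n\<in>{- int K..int K}.
      (1 + (real_of_int n)\<^sup>2) * (2 * (coeff (x t) n \<bullet> coeff (bbm_field (c t) (x t)) n)))) (at t within {0..})"
    unfolding energy_def
    by (intro has_vector_derivative_sum has_vector_derivative_mult_right 1)
  then show ?thesis by (simp only: 2 energy_flux_def Im_sum sum_distrib_left)
qed

text \<open>
  By the trilinear cancellation the flux through frequency \<open>K\<close> equals, up to sign, the sum over the
  frequencies beyond \<open>K\<close>, which is small for rapidly decreasing coefficients.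
\<close>

lemma energy_flux_le:
  assumes C: "\<And>n. (1 + \<bar>real_of_int n\<bar>) ^ 4 * cmod (coeff w n) \<le> C"
  shows "\<bar>energy_flux K w\<bar> \<le> C * (norm w)\<^sup>2 * (\<Sum>\<^sub>\<infinity>n::int. 1 / (1 + \<bar>real_of_int n\<bar>)\<^sup>2) / (1 + real K)"
proof -
  define Z where "Z n = 1 / (1 + \<bar>real_of_int n\<bar>)\<^sup>2" for n
  have Z: "Z summable_on UNIV" unfolding Z_def by (rule inverse_square_summable)
  have [simp]: "Z n \<ge> 0" for n by (simp add: Z_def)
  have "0 \<le> (1 + \<bar>real_of_int 0\<bar>) ^ 4 * cmod (coeff w 0)" by simp
  then have "C \<ge> 0" using C[of 0] by linarith
  have w: "\<bar>real_of_int n\<bar> * cmod (coeff w n) \<le> C * Z n / (1 + \<bar>real_of_int n\<bar>)" for n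
  proof -
    let ?W = "1 + \<bar>real_of_int n\<bar>"
    have "?W ^ 3 * (\<bar>real_of_int n\<bar> * cmod (coeff w n)) \<le> ?W ^ 3 * (?W * cmod (coeff w n))"
      by (intro mult_left_mono mult_right_mono) auto
    also have "\<dots> = ?W ^ 4 * cmod (coeff w n)" by (simp add: power4_eq_xxxx power3_eq_cube mult_ac)
    finally have "?W ^ 3 * (\<bar>real_of_int n\<bar> * cmod (coeff w n)) \<le> C" using C[of n] by linarith
    moreover have "?W > 0" by simp
    ultimately have "\<bar>real_of_int n\<bar> * cmod (coeff w n) \<le> C / ?W ^ 3"
      by (subst pos_le_divide_eq) (auto simp: mult.commute)
    also have "C / ?W ^ 3 = C * Z n / ?W" by (simp add: Z_def power3_eq_cube power2_eq_square)
    finally show ?thesis .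
  qed
  have "(\<lambda>n. \<bar>real_of_int n\<bar> * cmod (coeff w n)) summable_on UNIV"
  proof (rule summable_on_comparison_test[OF summable_on_cmult_right[OF Z, of C]])
    fix n
    have "C * Z n / (1 + \<bar>real_of_int n\<bar>) \<le> C * Z n"
      using divide_left_mono[of 1 "1 + \<bar>real_of_int n\<bar>" "C * Z n"] \<open>C \<ge> 0\<close> by simp
    then show "\<bar>real_of_int n\<bar> * cmod (coeff w n) \<le> C * Z n" using w[of n] by linarith
  qed auto
  note cancel = trilinear_cancellation[OF this]
  define f where "f n = of_int n * cnj (coeff w n) * coeff (conv w w) n" for n
  define A where "A = {- int K..int K}"
  have f: "(f has_sum 0) UNIV" using cancel by (simp add: f_def[abs_def])
  have fA: "f summable_on - A"
    by (rule summable_on_subset[OF has_sum_imp_summable[OF f]]) auto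
  have "((f has_sum (sum f A + infsum f (- A))) (A \<union> - A))"
    by (intro has_sum_Un_disjoint has_sum_infsum fA) (auto simp: A_def)
  then have "sum f A + infsum f (- A) = 0" using f by (simp add: has_sum_unique)
  then have "sum f A = - infsum f (- A)" by (rule eq_neg_iff_add_eq_0[THEN iffD2])
  moreover have "norm (infsum f (- A)) \<le> C * (norm w)\<^sup>2 / (1 + real K) * infsum Z (- A)"
  proof (rule norm_infsum_le)
    show "(f has_sum infsum f (- A)) (- A)" using fA by simp
    show "((\<lambda>n. C * (norm w)\<^sup>2 / (1 + real K) * Z n) has_sum
        C * (norm w)\<^sup>2 / (1 + real K) * infsum Z (- A)) (- A)"
      by (intro has_sum_cmult_right has_sum_infsum summable_on_subset[OF Z]) auto
  next
    fix n assume "n \<in> - A"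
    then have n: "1 + real K \<le> 1 + \<bar>real_of_int n\<bar>" by (auto simp: A_def)
    have "norm (f n) = (\<bar>real_of_int n\<bar> * cmod (coeff w n)) * cmod (coeff (conv w w) n)"
      by (simp add: f_def norm_mult)
    also have "\<dots> \<le> (C * Z n / (1 + real K)) * (norm w * norm w)"
    proof (rule mult_mono)
      have "C * Z n / (1 + \<bar>real_of_int n\<bar>) \<le> C * Z n / (1 + real K)"
        using n \<open>C \<ge> 0\<close> by (intro divide_left_mono) auto
      with w[of n] show "\<bar>real_of_int n\<bar> * cmod (coeff w n) \<le> C * Z n / (1 + real K)" by linarith
      show "cmod (coeff (conv w w) n) \<le> norm w * norm w"
        using coeff_le_norm norm_conv_le by (rule order.trans)
    qed (use \<open>C \<ge> 0\<close> in auto)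
    finally show "norm (f n) \<le> C * (norm w)\<^sup>2 / (1 + real K) * Z n"
      by (simp add: power2_eq_square mult_ac)
  qed
  moreover have "C * (norm w)\<^sup>2 / (1 + real K) * infsum Z (- A)
    \<le> C * (norm w)\<^sup>2 / (1 + real K) * infsum Z UNIV"
    using \<open>C \<ge> 0\<close> by (intro mult_left_mono infsum_mono2 summable_on_subset[OF Z] Z) auto
  moreover have "\<bar>energy_flux K w\<bar> \<le> norm (sum f A)"
    unfolding energy_flux_def f_def A_def by (rule abs_Im_le_cmod)
  ultimately have "\<bar>energy_flux K w\<bar> \<le> C * (norm w)\<^sup>2 / (1 + real K) * infsum Z UNIV" by simp
  then show ?thesis unfolding Z_def[abs_def] by (simp add: mult_ac)
qed

text \<open>
  The low-frequency energy grows at most by a flux that vanishes as the truncation is removed.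
\<close>

lemma energy_le_initial:
  assumes flow: "bbm_flow c x" and x0: "rapid_decay (coeff (x 0))"
    and E: "\<And>K. energy K (x 0) \<le> E" and "t \<ge> 0"
  shows "energy K (x t) \<le> E"
proof -
  obtain C where C: "\<And>s n. s \<in> {0..t} \<Longrightarrow> (1 + \<bar>real_of_int n\<bar>) ^ 4 * cmod (coeff (x s) n) \<le> C"
    using flow_decay[OF flow x0] by blast
  obtain B where B: "B \<ge> 0" "\<And>s. s \<in> {0..t} \<Longrightarrow> norm (x s) \<le> B" using flow_bounded[OF flow] by blast
  have "0 \<le> (1 + \<bar>real_of_int 0\<bar>) ^ 4 * cmod (coeff (x 0) 0)" by simp
  also have "\<dots> \<le> C" using \<open>t \<ge> 0\<close> by (intro C) auto
  finally have "C \<ge> 0" .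
  define D where "D = C * B\<^sup>2 * (\<Sum>\<^sub>\<infinity>n::int. 1 / (1 + \<bar>real_of_int n\<bar>)\<^sup>2)"
  have le: "energy K (x t) \<le> E + D * t / (1 + real K')" if "K' \<ge> K" for K'
  proof -
    have "norm (energy K' (x t) - energy K' (x 0)) \<le> D / (1 + real K') * (t - 0)"
    proof (rule increment_le[OF energy_deriv[OF flow]])
      fix s assume s: "0 < s" "s < t"
      have "\<bar>energy_flux K' (x s)\<bar>
        \<le> C * (norm (x s))\<^sup>2 * (\<Sum>\<^sub>\<infinity>n::int. 1 / (1 + \<bar>real_of_int n\<bar>)\<^sup>2) / (1 + real K')"
        using s by (intro energy_flux_le C) auto
      also have "\<dots> \<le> D / (1 + real K')"
        unfolding D_def using s B(2)[of s] \<open>C \<ge> 0\<close>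
        by (intro divide_right_mono mult_right_mono mult_left_mono power_mono infsum_nonneg) auto
      finally have "\<bar>energy_flux K' (x s)\<bar> \<le> D / (1 + real K')" .
      moreover have "\<bar>c s\<bar> * \<bar>energy_flux K' (x s)\<bar> \<le> 1 * \<bar>energy_flux K' (x s)\<bar>"
        using flow_cutoff_range[OF flow, of s] s by (intro mult_right_mono) auto
      ultimately show "norm (c s * energy_flux K' (x s)) \<le> D / (1 + real K')"
        by (simp add: abs_mult)
    qed (use \<open>t \<ge> 0\<close> in auto)
    then show ?thesis using E[of K'] energy_mono[OF that, of "x t"] by simp
  qed
  have "(\<lambda>K'. E + D * t / (1 + real K')) \<longlonglongrightarrow> E + 0"
    by (intro tendsto_add tendsto_const real_tendsto_divide_at_top[OF tendsto_const]
        filterlim_tendsto_add_at_top[OF tendsto_const] filterlim_real_sequentially)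
  then have "(\<lambda>K'. E + D * t / (1 + real K')) \<longlonglongrightarrow> E" by simp
  then show ?thesis
    by (rule tendsto_lowerbound) (auto simp: eventually_sequentially intro!: exI[of _ K] le)
qed

text \<open>
  By the inequality between the arithmetic and the geometric mean, \<open>\<bar>w n\<bar>\<close> is at most half of
  \<open>(1 + n\<^sup>2) \<bar>w n\<bar>\<^sup>2 + 1 / (1 + n\<^sup>2)\<close>.
\<close>

lemma norm_le_energy:
  assumes E: "\<And>K. energy K w \<le> E"
  shows "norm w \<le> (E + (\<Sum>\<^sub>\<infinity>n. 1 / (1 + (real_of_int n)\<^sup>2))) / 2"
proof (rule norm_wiener_leI)
  fix A :: "int set" assume A: "finite A"
  have pos: "1 + (real_of_int n)\<^sup>2 > 0" for n by (rule add_pos_nonneg) auto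
  have s: "(\<lambda>n. 1 / (1 + (real_of_int n)\<^sup>2)) summable_on UNIV"
  proof (rule summable_on_comparison_test[OF summable_on_cmult_right[OF inverse_square_summable, of 2]])
    fix n
    have "0 \<le> (1 - \<bar>real_of_int n\<bar>)\<^sup>2" by simp
    then have "(1 + \<bar>real_of_int n\<bar>)\<^sup>2 \<le> 2 * (1 + (real_of_int n)\<^sup>2)"
      by (simp add: power2_eq_square algebra_simps)
    moreover have "(1 + \<bar>real_of_int n\<bar>)\<^sup>2 > 0" by (intro zero_less_power) auto
    ultimately show "1 / (1 + (real_of_int n)\<^sup>2) \<le> 2 * (1 / (1 + \<bar>real_of_int n\<bar>)\<^sup>2)"
      using pos[of n] by (simp add: frac_le_eq field_simps)
  qed (use pos in \<open>auto intro: less_imp_le\<close>)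
  define K where "K = nat (Max (abs ` insert 0 A))"
  have "\<bar>n\<bar> \<le> Max (abs ` insert 0 A)" if "n \<in> A" for n
    using A that by (intro Max_ge) auto
  then have K: "A \<subseteq> {- int K..int K}" by (fastforce simp: K_def)
  have "(\<Sum>n\<in>A. cmod (coeff w n)) \<le> (\<Sum>n\<in>{- int K..int K}. cmod (coeff w n))"
    using K by (intro sum_mono2) auto
  also have "\<dots> \<le> (\<Sum>n\<in>{- int K..int K}.
      ((1 + (real_of_int n)\<^sup>2) * (cmod (coeff w n))\<^sup>2 + 1 / (1 + (real_of_int n)\<^sup>2)) / 2)"
  proof (rule sum_mono)
    fix n
    let ?p = "1 + (real_of_int n)\<^sup>2"
    have "0 \<le> (?p * cmod (coeff w n) - 1)\<^sup>2 / ?p" using pos[of n] by simp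
    also have "\<dots> = ?p * (cmod (coeff w n))\<^sup>2 + 1 / ?p - 2 * cmod (coeff w n)"
      using pos[of n] by (simp add: power2_eq_square field_simps)
    finally show "cmod (coeff w n) \<le> (?p * (cmod (coeff w n))\<^sup>2 + 1 / ?p) / 2" by simp
  qed
  also have "\<dots> = (energy K w + (\<Sum>n\<in>{- int K..int K}. 1 / (1 + (real_of_int n)\<^sup>2))) / 2"
    by (simp add: energy_def sum.distrib flip: sum_divide_distrib)
  also have "\<dots> \<le> (E + (\<Sum>\<^sub>\<infinity>n. 1 / (1 + (real_of_int n)\<^sup>2))) / 2"
    using pos by (intro divide_right_mono add_mono E finite_sum_le_infsum[OF s]) (auto intro: less_imp_le)
  finally show "(\<Sum>n\<in>A. cmod (coeff w n)) \<le> (E + (\<Sum>\<^sub>\<infinity>n. 1 / (1 + (real_of_int n)\<^sup>2))) / 2" .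
qed

section \<open>Global smooth solutions\<close>

text \<open>
  The cutoff radius exceeds the a priori bound that the energy of the initial value puts on the Wiener
  norm of the damped solution, so that the damping factor is constantly 1.
\<close>

lemma bbm_global_flow:
  assumes w: "rapid_decay (coeff w)"
  obtains x where "x 0 = w" "bbm_flow (\<lambda>_. 1) x"
proof -
  obtain C where C: "\<And>n. (1 + \<bar>real_of_int n\<bar>)\<^sup>2 * cmod (coeff w n) \<le> C"
    using w unfolding rapid_decay_def by blast
  have "0 \<le> (1 + \<bar>real_of_int 0\<bar>)\<^sup>2 * cmod (coeff w 0)" by simp
  then have "C \<ge> 0" using C[of 0] by linarith
  have E: "energy K w \<le> C * norm w" for K
  proof -
    have "energy K w \<le> (\<Sum>n\<in>{- int K..int K}. C * cmod (coeff w n))"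
      unfolding energy_def
    proof (rule sum_mono)
      fix n
      have "(1 + (real_of_int n)\<^sup>2) * cmod (coeff w n) \<le> (1 + \<bar>real_of_int n\<bar>)\<^sup>2 * cmod (coeff w n)"
        by (intro mult_right_mono) (auto simp: power2_sum)
      then have "(1 + (real_of_int n)\<^sup>2) * cmod (coeff w n) \<le> C" using C[of n] by linarith
      from mult_right_mono[OF this norm_ge_zero]
      show "(1 + (real_of_int n)\<^sup>2) * (cmod (coeff w n))\<^sup>2 \<le> C * cmod (coeff w n)"
        by (simp add: power2_eq_square mult_ac)
    qed
    also have "\<dots> \<le> C * norm w"
      unfolding sum_distrib_left[symmetric] using \<open>C \<ge> 0\<close> by (intro mult_left_mono sum_coeff_le_norm) auto
    finally show ?thesis .
  qed
  define R where "R = (C * norm w + (\<Sum>\<^sub>\<infinity>n. 1 / (1 + (real_of_int n)\<^sup>2))) / 2 + 1"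
  have "(\<Sum>\<^sub>\<infinity>n. 1 / (1 + (real_of_int n)\<^sup>2)) \<ge> 0" by (intro infsum_nonneg) simp
  then have "R > 0" using \<open>C \<ge> 0\<close> by (simp add: R_def add_nonneg_pos)
  from lipschitz_ode_global_solution[OF cutoff_bbm_field_lipschitz[OF this], of w]
  obtain x where x: "x 0 = w"
    and dx: "\<And>t. t \<ge> 0 \<Longrightarrow>
      (x has_vector_derivative bbm_field ((radial_cutoff R (x t))\<^sup>2) (x t)) (at t within {0..})"
    by blast
  have flow: "bbm_flow (\<lambda>t. (radial_cutoff R (x t))\<^sup>2) x"
    using dx radial_cutoff_bounds[OF \<open>R > 0\<close>] by (auto simp: bbm_flow_def intro!: power_le_one)
  have "radial_cutoff R (x t) = 1" if "t \<ge> 0" for t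
  proof (rule radial_cutoff_eq_1[OF \<open>R > 0\<close>])
    have "energy K (x t) \<le> C * norm w" for K
      by (rule energy_le_initial[OF flow _ _ that]) (simp_all add: x w E)
    from norm_le_energy[OF this] show "norm (x t) \<le> R" unfolding R_def by linarith
  qed
  then have "bbm_flow (\<lambda>_. 1) x" using dx by (simp add: bbm_flow_def)
  with x show ?thesis by (rule that)
qed

lemma jap_ge_1: "jap n \<ge> 1"
  by (simp add: jap_def)

lemma jap_le: "jap n \<le> 1 + \<bar>real_of_int n\<bar>"
  unfolding jap_def by (rule real_le_lsqrt) (auto simp: power2_sum)

lemma Hs_decay:
  assumes f: "\<And>n. (1 + \<bar>real_of_int n\<bar>) ^ k * cmod (f n) \<le> C" and k: "\<sigma> + 1 \<le> real k" "k \<ge> 1"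
  shows "f \<in> Hs \<sigma>"
    and "Hs_norm \<sigma> f \<le> C * sqrt (\<Sum>\<^sub>\<infinity>n::int. 1 / (1 + \<bar>real_of_int n\<bar>)\<^sup>2)"
proof -
  have "0 \<le> (1 + \<bar>real_of_int 0\<bar>) ^ k * cmod (f 0)" by simp
  then have "C \<ge> 0" using f[of 0] by linarith
  have le: "jap n powr (2 * \<sigma>) * (cmod (f n))\<^sup>2 \<le> C\<^sup>2 * (1 / (1 + \<bar>real_of_int n\<bar>)\<^sup>2)" for n
  proof -
    let ?W = "1 + \<bar>real_of_int n\<bar>"
    have W: "?W > 0" by simp
    have "jap n powr (2 * \<sigma>) \<le> jap n powr (2 * (real k - 1))"
      using k jap_ge_1 by (intro powr_mono) auto
    also have "\<dots> \<le> ?W powr (2 * (real k - 1))"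
      using k jap_ge_1[of n] jap_le[of n] by (intro powr_mono2) auto
    finally have "jap n powr (2 * \<sigma>) * ?W\<^sup>2 \<le> ?W powr (2 * (real k - 1)) * ?W\<^sup>2"
      by (intro mult_right_mono) auto
    also have "\<dots> = ?W powr (2 * (real k - 1)) * ?W powr 2" using W by (simp add: powr_numeral)
    also have "\<dots> = ?W powr (real (2 * k))" unfolding powr_add[symmetric] by simp
    also have "\<dots> = (?W ^ k)\<^sup>2" using W by (simp only: powr_realpow power_mult[symmetric] mult.commute)
    finally have "jap n powr (2 * \<sigma>) * ?W\<^sup>2 * (cmod (f n))\<^sup>2 \<le> (?W ^ k)\<^sup>2 * (cmod (f n))\<^sup>2"
      by (intro mult_right_mono) auto
    also have "\<dots> = (?W ^ k * cmod (f n))\<^sup>2" by (simp only: power_mult_distrib)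
    also have "\<dots> \<le> C\<^sup>2" using f[of n] by (intro power_mono) auto
    finally have "(jap n powr (2 * \<sigma>) * (cmod (f n))\<^sup>2) * ?W\<^sup>2 \<le> C\<^sup>2" by (simp only: mult_ac)
    then show ?thesis using W by (simp add: pos_le_divide_eq)
  qed
  note s = summable_on_cmult_right[OF inverse_square_summable, of "C\<^sup>2"]
  have 1: "(\<lambda>n. jap n powr (2 * \<sigma>) * (cmod (f n))\<^sup>2) summable_on UNIV"
    by (rule summable_on_comparison_test[OF s le]) auto
  then show "f \<in> Hs \<sigma>" by (simp add: Hs_def)
  have "Hs_norm \<sigma> f \<le> sqrt (\<Sum>\<^sub>\<infinity>n::int. C\<^sup>2 * (1 / (1 + \<bar>real_of_int n\<bar>)\<^sup>2))"
    unfolding Hs_norm_def by (intro real_sqrt_le_mono infsum_mono 1 s le)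
  also have "\<dots> = C * sqrt (\<Sum>\<^sub>\<infinity>n::int. 1 / (1 + \<bar>real_of_int n\<bar>)\<^sup>2)"
    unfolding infsum_cmult_right' using \<open>C \<ge> 0\<close> by (simp add: real_sqrt_mult)
  finally show "Hs_norm \<sigma> f \<le> C * sqrt (\<Sum>\<^sub>\<infinity>n::int. 1 / (1 + \<bar>real_of_int n\<bar>)\<^sup>2)" .
qed

lemma Hs_norm_nonneg: "Hs_norm \<sigma> f \<ge> 0"
  unfolding Hs_norm_def by (intro real_sqrt_ge_zero infsum_nonneg) simp

lemma Hs_norm_minus_commute: "Hs_norm \<sigma> (\<lambda>n. f n - h n) = Hs_norm \<sigma> (\<lambda>n. h n - f n)"
  by (simp add: Hs_norm_def norm_minus_commute)

lemma flow_CHs: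
  assumes flow: "bbm_flow c x" and x0: "rapid_decay (coeff (x 0))"
  shows "(\<lambda>t. coeff (x t)) \<in> CHs {0..} \<sigma>"
proof -
  define k where "k = nat \<lceil>\<bar>\<sigma>\<bar>\<rceil>"
  have k: "\<sigma> + 1 \<le> real (Suc k)"
    unfolding k_def of_nat_Suc using real_nat_ceiling_ge[of "\<bar>\<sigma>\<bar>"] by linarith
  define Z where "Z = sqrt (\<Sum>\<^sub>\<infinity>n::int. 1 / (1 + \<bar>real_of_int n\<bar>)\<^sup>2)"
  have "coeff (x t) \<in> Hs \<sigma> \<and>
    ((\<lambda>t'. Hs_norm \<sigma> (\<lambda>n. coeff (x t') n - coeff (x t) n)) \<longlongrightarrow> 0) (at t within {0..})"
    if "t \<ge> 0" for t
  proof
    have "t \<in> {0..t}" using that by simp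
    then obtain D where "\<And>n. (1 + \<bar>real_of_int n\<bar>) ^ Suc k * cmod (coeff (x t) n) \<le> D"
      using flow_decay[OF flow x0, of t "Suc k"] by blast
    then show "coeff (x t) \<in> Hs \<sigma>" by (rule Hs_decay(1)[OF _ k]) simp
    obtain C where "\<And>s n. s \<in> {0..t + 1} \<Longrightarrow> (1 + \<bar>real_of_int n\<bar>) ^ k * cmod (coeff (x s) n) \<le> C"
      using flow_decay[OF flow x0] by blast
    from flow_coeff_lipschitz[OF flow this] obtain K where
      K: "\<And>a b n. 0 \<le> a \<Longrightarrow> a \<le> b \<Longrightarrow> b \<le> t + 1 \<Longrightarrow>
        (1 + \<bar>real_of_int n\<bar>) ^ Suc k * cmod (coeff (x b) n - coeff (x a) n) \<le> K * (b - a)"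
      by metis
    have le: "Hs_norm \<sigma> (\<lambda>n. coeff (x b) n - coeff (x a) n) \<le> K * (b - a) * Z"
      if "0 \<le> a" "a \<le> b" "b \<le> t + 1" for a b
      unfolding Z_def by (rule Hs_decay(2)[OF K[OF that] k]) simp
    show "((\<lambda>t'. Hs_norm \<sigma> (\<lambda>n. coeff (x t') n - coeff (x t) n)) \<longlongrightarrow> 0) (at t within {0..})"
    proof (rule tendsto_sandwich[OF _ _ tendsto_const])
      show "\<forall>\<^sub>F t' in at t within {0..}. 0 \<le> Hs_norm \<sigma> (\<lambda>n. coeff (x t') n - coeff (x t) n)"
        by (simp add: Hs_norm_nonneg)
      have "\<forall>\<^sub>F t' in at t within {0..}. t' \<in> {0..} \<and> t' \<in> {..<t + 1}"
        unfolding eventually_at by (intro exI[of _ 1]) (auto simp: dist_real_def)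
      then show "\<forall>\<^sub>F t' in at t within {0..}.
          Hs_norm \<sigma> (\<lambda>n. coeff (x t') n - coeff (x t) n) \<le> K * \<bar>t' - t\<bar> * Z"
      proof eventually_elim
        case (elim t')
        then show ?case
          using le[of t t'] le[of t' t] that Hs_norm_minus_commute[of \<sigma> "coeff (x t')" "coeff (x t)"]
          by (cases "t \<le> t'") auto
      qed
      have "((\<lambda>t'. K * \<bar>t' - t\<bar> * Z) \<longlongrightarrow> K * \<bar>t - t\<bar> * Z) (at t within {0..})"
        by (intro tendsto_intros)
      then show "((\<lambda>t'. K * \<bar>t' - t\<bar> * Z) \<longlongrightarrow> 0) (at t within {0..})" by simp
    qed
  qed
  then show ?thesis by (simp add: CHs_def)
qed

text \<open>
  Duhamel's formula is the fundamental theorem of calculus for each coefficient times the integrating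
  factor \<open>exp (- i (t - s) \<phi>(n))\<close>.
\<close>

lemma flow_duhamel:
  assumes flow: "bbm_flow (\<lambda>_. 1) x"
  shows "duhamel {0..} (coeff (x 0)) (\<lambda>t. bbm_nonlinearity (coeff (x t))) (\<lambda>t. coeff (x t))"
  unfolding duhamel_def
proof (intro ballI allI)
  fix t :: real and n :: int
  assume "t \<in> {0..}"
  then have t: "t \<ge> 0" by simp
  define P where "P s = exp (- (\<i> * of_real ((t - s) * phi n)))" for s
  define q where "q s = coeff (conv (x s) (x s)) n" for s
  have F: "propagator (t - s) (bbm_nonlinearity (coeff (x s))) n = P s * (of_real (phi n) * q s)" for s
    by (simp add: propagator_def bbm_nonlinearity_def P_def q_def conv.rep_eq)
  have contq: "continuous_on {0..t} q"
    unfolding q_def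
    by (intro bounded_linear.continuous_on[OF bounded_linear_coeff] conv.continuous_on
        continuous_on_subset[OF flow_continuous[OF flow]]) auto
  have dP: "(P has_vector_derivative \<i> * of_real (phi n) * P s) (at s within S)" for s S
  proof -
    have "((\<lambda>z. exp (- (\<i> * ((of_real t - z) * of_real (phi n))))) has_field_derivative
        \<i> * of_real (phi n) * exp (- (\<i> * ((of_real t - of_real s) * of_real (phi n))))) (at (of_real s))"
      by (auto intro!: derivative_eq_intros)
    from has_vector_derivative_real_field[OF this] show ?thesis by (simp add: P_def[abs_def])
  qed
  have contP: "continuous_on {0..t} P"
    by (rule continuous_on_vector_derivative[OF dP])
  show "(\<lambda>t'. propagator (t - t') (bbm_nonlinearity (coeff (x t'))) n) absolutely_integrable_on {0..t} \<and>
    coeff (x t) n = propagator t (coeff (x 0)) n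
      - \<i> / 2 * integral {0..t} (\<lambda>t'. propagator (t - t') (bbm_nonlinearity (coeff (x t'))) n)"
  proof
    show "(\<lambda>t'. propagator (t - t') (bbm_nonlinearity (coeff (x t'))) n) absolutely_integrable_on {0..t}"
      unfolding F by (intro absolutely_integrable_continuous_real continuous_intros contP contq)
    have "((\<lambda>s. - \<i> / 2 * (P s * (of_real (phi n) * q s))) has_integral
        P t * coeff (x t) n - P 0 * coeff (x 0) n) {0..t}"
    proof (rule fundamental_theorem_of_calculus[OF t])
      fix s assume s: "s \<in> {0..t}"
      have "((\<lambda>s. coeff (x s) n) has_vector_derivative coeff (bbm_field 1 (x s)) n) (at s within {0..t})"
        using flow_coeff_deriv[OF flow, of s n] s by (auto elim: has_vector_derivative_within_subset)
      from has_vector_derivative_mult[OF dP this]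
      show "((\<lambda>s. P s * coeff (x s) n) has_vector_derivative - \<i> / 2 * (P s * (of_real (phi n) * q s)))
          (at s within {0..t})"
        by (rule has_vector_derivative_eq_rhs) (simp add: coeff_bbm_field q_def algebra_simps)
    qed
    from integral_unique[OF this]
    have "- \<i> / 2 * integral {0..t} (\<lambda>s. P s * (of_real (phi n) * q s))
      = P t * coeff (x t) n - P 0 * coeff (x 0) n" by simp
    moreover have "P t = 1" "P 0 * coeff (x 0) n = propagator t (coeff (x 0)) n"
      by (simp_all add: P_def propagator_def)
    ultimately show "coeff (x t) n = propagator t (coeff (x 0)) n
      - \<i> / 2 * integral {0..t} (\<lambda>t'. propagator (t - t') (bbm_nonlinearity (coeff (x t'))) n)"
      unfolding F by (simp add: algebra_simps)
  qed
qed

lemma flow_smooth_bbm_solution: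
  assumes "bbm_flow (\<lambda>_. 1) x" "rapid_decay (coeff (x 0))"
  shows "smooth_bbm_solution (\<lambda>t. coeff (x t))"
  using flow_CHs[OF assms] flow_duhamel[OF assms(1)]
  by (simp add: smooth_bbm_solution_def coeff_real_valued)

section \<open>Growth of the first Fourier mode\<close>

lemma norm_bbm_field_le:
  assumes "norm w \<le> H"
  shows "norm (bbm_field 1 w) \<le> H / 2 + H\<^sup>2 / 4"
proof -
  have "norm (conv w w) \<le> H * H"
    using norm_conv_le[of w w] mult_mono'[OF assms assms] by simp
  then have "norm (w + (1 / 2) *\<^sub>R conv w w) \<le> H + H * H / 2"
    using assms by (intro norm_triangle_mono) auto
  then show ?thesis
    using norm_bbm_multiplier_le[of "w + (1 / 2) *\<^sub>R conv w w"]
    by (simp add: bbm_field_def power2_eq_square)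
qed

text \<open>
  Until the norm first reaches \<open>H\<close>, the velocity is at most \<open>H / 2 + H\<^sup>2 / 4\<close>, and at that speed the
  solution cannot cover the distance to norm \<open>H\<close> before time \<open>t\<close>.
\<close>

lemma flow_stays_bounded:
  assumes flow: "bbm_flow (\<lambda>_. 1) x" and H: "0 \<le> H" "norm (x 0) + (H / 2 + H\<^sup>2 / 4) * t < H"
    and s: "0 \<le> s" "s \<le> t"
  shows "norm (x s) < H" "norm (x s - x 0) \<le> (H / 2 + H\<^sup>2 / 4) * s"
proof -
  define K where "K = H / 2 + H\<^sup>2 / 4"
  have incr: "norm (x s - x 0) \<le> K * s" if "0 \<le> s" "\<And>r. 0 < r \<Longrightarrow> r < s \<Longrightarrow> norm (x r) \<le> H" for s
    using increment_le[OF flow_deriv[OF flow], of 0 s K] that norm_bbm_field_le by (auto simp: K_def)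
  have "norm (x r) < H" if r: "r \<in> {0..t}" for r
  proof (rule ccontr)
    assume "\<not> norm (x r) < H"
    \<comment> \<open>the first time \<open>a\<close> at which the norm reaches \<open>H\<close>\<close>
    define S where "S = {0..t} \<inter> (\<lambda>r. norm (x r)) -` {H..}"
    have "continuous_on {0..t} (\<lambda>r. norm (x r))"
      by (intro continuous_intros continuous_on_subset[OF flow_continuous[OF flow]]) auto
    then have "closed S" unfolding S_def by (intro continuous_closed_preimage) auto
    then have "compact ({0..t} \<inter> S)" by (rule compact_Int_closed[OF compact_Icc])
    moreover have "{0..t} \<inter> S = S" by (auto simp: S_def)
    ultimately have "compact S" by simp
    moreover have "S \<noteq> {}" using r \<open>\<not> norm (x r) < H\<close> by (auto simp: S_def)
    ultimately obtain a where a: "a \<in> S" "\<And>r. r \<in> S \<Longrightarrow> a \<le> r"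
      using compact_attains_inf by metis
    then have a': "0 \<le> a" "a \<le> t" "norm (x a) \<ge> H" by (auto simp: S_def)
    have "norm (x a - x 0) \<le> K * a"
    proof (rule incr[OF a'(1)])
      fix r assume "0 < r" "r < a"
      then show "norm (x r) \<le> H" using a(2)[of r] a' by (force simp: S_def)
    qed
    moreover have "K \<ge> 0" using \<open>H \<ge> 0\<close> by (simp add: K_def)
    then have "K * a \<le> K * t" using a' by (intro mult_left_mono) auto
    ultimately show False
      using a'(3) H(2) norm_triangle_sub[of "x a" "x 0"] unfolding K_def by linarith
  qed
  note bound = this
  show "norm (x s) < H" using bound s by auto
  have "norm (x s - x 0) \<le> K * s" using s bound by (intro incr) (auto intro: less_imp_le)
  then show "norm (x s - x 0) \<le> (H / 2 + H\<^sup>2 / 4) * s" by (simp add: K_def)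
qed

text \<open>
  The first mode moves as if the quadratic term were frozen at time 0, with velocity
  \<open>- i / 4\<close> times its first coefficient, because \<open>\<phi>(1) / 2 = 1 / 4\<close>.  Up to time \<open>t\<close> the solution
  has norm at most \<open>10 A\<close>, hence velocity at most \<open>30 A\<^sup>2\<close>, and it is displaced by at most
  \<open>3 A / 100\<close>; the error is the linear term and the effect of this displacement on the square.
\<close>

lemma first_mode_expansion:
  assumes flow: "bbm_flow (\<lambda>_. 1) x" and A: "A \<ge> 1" "norm (x 0) \<le> 5 * A"
    and t: "t = 1 / (1000 * A)"
  shows "cmod (coeff (x t) 1 - coeff (x 0) 1 + \<i> / 4 * of_real t * coeff (conv (x 0) (x 0)) 1)
    \<le> 1 / 100 + A / 8000"
proof -
  have "t \<ge> 0" using A t by simp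
  have At: "A * t = 1 / 1000" "A\<^sup>2 * t = A / 1000" using A by (auto simp: t power2_eq_square)
  define K where "K = 10 * A / 2 + (10 * A)\<^sup>2 / 4"
  have "A * 1 \<le> A * A" using A by (intro mult_left_mono) auto
  then have K: "0 \<le> K" "K \<le> 30 * A\<^sup>2" using A by (auto simp: K_def power2_eq_square)
  then have Kt: "K * t \<le> 3 / 100 * A"
    using mult_right_mono[OF K(2) \<open>t \<ge> 0\<close>] At by simp
  have H: "norm (x 0) + (10 * A / 2 + (10 * A)\<^sup>2 / 4) * t < 10 * A"
    using Kt A unfolding K_def by linarith
  have "0 \<le> 10 * A" using A by simp
  note stays = flow_stays_bounded[OF flow this H]
  \<comment> \<open>the deviation from the frozen motion, whose velocity is small\<close>
  define f where "f s = coeff (x s) 1 + \<i> / 4 * of_real s * coeff (conv (x 0) (x 0)) 1" for s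
  have "norm (f t - f 0) \<le> (5 * A + 9 / 80 * A\<^sup>2) * (t - 0)"
  proof (rule increment_le)
    fix s :: real assume "s \<ge> 0"
    have "((\<lambda>s. \<i> / 4 * of_real s * coeff (conv (x 0) (x 0)) 1) has_vector_derivative
        \<i> / 4 * coeff (conv (x 0) (x 0)) 1) (at s within {0..})"
      by (rule has_vector_derivative_real_field) (auto intro!: derivative_eq_intros)
    with flow_coeff_deriv[OF flow \<open>s \<ge> 0\<close>, of 1]
    show "(f has_vector_derivative coeff (bbm_field 1 (x s)) 1
        + \<i> / 4 * coeff (conv (x 0) (x 0)) 1) (at s within {0..})"
      unfolding f_def by (rule has_vector_derivative_add)
  next
    fix s assume s: "0 < s" "s < t"
    have b: "norm (x s) \<le> 10 * A" "norm (x s - x 0) \<le> 3 / 100 * A"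
    proof -
      show "norm (x s) \<le> 10 * A" using stays(1)[of s] s by auto
      have "norm (x s - x 0) \<le> K * s"
        using stays(2)[of s] s by (auto simp: K_def)
      also have "\<dots> \<le> K * t" using K s by (intro mult_left_mono) auto
      finally show "norm (x s - x 0) \<le> 3 / 100 * A" using Kt by linarith
    qed
    have "norm (conv (x s) (x s) - conv (x 0) (x 0))
      \<le> norm (x s - x 0) * norm (x s) + norm (x 0) * norm (x s - x 0)"
      unfolding conv_diff_square by (intro norm_triangle_mono norm_conv_le)
    also have "\<dots> \<le> (3 / 100 * A) * (10 * A) + (5 * A) * (3 / 100 * A)"
      using A b by (intro add_mono mult_mono) auto
    finally have q: "norm (conv (x s) (x s) - conv (x 0) (x 0)) \<le> 9 / 20 * A\<^sup>2"
      by (simp add: power2_eq_square)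
    have phi1: "phi 1 = 1 / 2" by (simp add: phi_def)
    have "coeff (bbm_field 1 (x s)) 1 + \<i> / 4 * coeff (conv (x 0) (x 0)) 1
      = - (\<i> / 2 * coeff (x s) 1 + \<i> / 4 * coeff (conv (x s) (x s) - conv (x 0) (x 0)) 1)"
      by (simp add: coeff_bbm_field phi1 algebra_simps)
    moreover have "norm (\<i> / 2 * coeff (x s) 1) \<le> 5 * A"
      using coeff_le_norm[of "x s" 1] b by (simp add: norm_mult norm_divide)
    moreover have "norm (\<i> / 4 * coeff (conv (x s) (x s) - conv (x 0) (x 0)) 1) \<le> 9 / 80 * A\<^sup>2"
      using coeff_le_norm[of "conv (x s) (x s) - conv (x 0) (x 0)" 1] q
      by (simp add: norm_mult norm_divide del: coeff_simps)
    ultimately show "norm (coeff (bbm_field 1 (x s)) 1 + \<i> / 4 * coeff (conv (x 0) (x 0)) 1)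
      \<le> 5 * A + 9 / 80 * A\<^sup>2"
      by (simp only: norm_minus_cancel norm_triangle_mono)
  qed (use \<open>t \<ge> 0\<close> in auto)
  also have "\<dots> = 5 * (A * t) + 9 / 80 * (A\<^sup>2 * t)" by (simp add: algebra_simps)
  also have "\<dots> \<le> 1 / 100 + A / 8000" using A by (simp add: At)
  finally show ?thesis by (simp add: f_def algebra_simps)
qed

text \<open>
  The coefficients of \<open>2 cos (N x) + 2 cos ((N + 1) x)\<close>.  Two adjacent frequencies are needed because
  the square of a single cosine reaches only the frequencies 0 and \<open>2 N\<close>, and \<open>\<phi>(0) = 0\<close>.
\<close>

definition resonant_pair :: "nat \<Rightarrow> fourier"
  where "resonant_pair N n = (if \<bar>n\<bar> = int N \<or> \<bar>n\<bar> = int N + 1 then 1 else 0)"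

definition frequency_truncation :: "nat \<Rightarrow> fourier \<Rightarrow> fourier"
  where "frequency_truncation K f n = (if \<bar>n\<bar> \<le> int K then f n else 0)"

lemma coeff_Wiener_bounded_support:
  assumes "\<And>n. \<bar>n\<bar> > int L \<Longrightarrow> f n = 0" "real_valued f"
  shows "coeff (Wiener f) = f"
proof (rule coeff_Wiener[OF _ assms(2)])
  have "n \<in> {- int L..int L}" if "f n \<noteq> 0" for n
    using assms(1)[of n] that by (cases "\<bar>n\<bar> > int L") auto
  then have "{n. cmod (f n) \<noteq> 0} \<subseteq> {- int L..int L}" by auto
  then have "finite {n. cmod (f n) \<noteq> 0}" by (rule finite_subset) simp
  then show "(\<lambda>n. cmod (f n)) summable_on UNIV"
    by (intro finite_nonzero_values_imp_summable_on) simp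
qed

lemma rapid_decay_bounded_support:
  assumes "\<And>n. \<bar>n\<bar> > int L \<Longrightarrow> f n = 0"
  shows "rapid_decay f"
  unfolding rapid_decay_def
proof
  fix k
  define C where "C = (\<Sum>n\<in>{- int L..int L}. (1 + \<bar>real_of_int n\<bar>) ^ k * cmod (f n))"
  have "(1 + \<bar>real_of_int n\<bar>) ^ k * cmod (f n) \<le> C" for n
  proof (cases "\<bar>n\<bar> > int L")
    case True
    then show ?thesis using assms by (auto simp: C_def intro!: sum_nonneg)
  next
    case False
    then show ?thesis unfolding C_def by (intro member_le_sum) auto
  qed
  then show "\<exists>C. \<forall>n. (1 + \<bar>real_of_int n\<bar>) ^ k * cmod (f n) \<le> C" by blast
qed

lemma resonant_pair_support: "\<bar>n\<bar> > int (N + 1) \<Longrightarrow> resonant_pair N n = 0"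
  by (auto simp: resonant_pair_def)

lemma coeff_resonant_pair: "coeff (Wiener (resonant_pair N)) = resonant_pair N"
  by (rule coeff_Wiener_bounded_support[of "N + 1", OF resonant_pair_support])
     (auto simp: real_valued_def resonant_pair_def)

text \<open>
  A common source for the bounds of the Wiener norm and of the Sobolev norms: only four frequencies
  contribute.
\<close>

lemma sum_resonant_pair_le:
  assumes "finite A" "\<And>n. \<bar>n\<bar> \<ge> int N \<Longrightarrow> v n \<le> B" "B \<ge> 0"
  shows "(\<Sum>n\<in>A. v n * (cmod (resonant_pair N n))\<^sup>2) \<le> 4 * (B :: real)"
proof -
  define S where "S = {int N, int N + 1, - int N, - int N - 1}"
  have "(\<Sum>n\<in>A. v n * (cmod (resonant_pair N n))\<^sup>2) = (\<Sum>n\<in>A \<inter> S. v n * (cmod (resonant_pair N n))\<^sup>2)"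
    using assms(1) by (intro sum.mono_neutral_right) (auto simp: S_def resonant_pair_def)
  also have "\<dots> \<le> (\<Sum>n\<in>A \<inter> S. B)"
    using assms by (intro sum_mono) (auto simp: S_def resonant_pair_def)
  also have "\<dots> = real (card (A \<inter> S)) * B" by simp
  also have "\<dots> \<le> 4 * B"
  proof (rule mult_right_mono)
    have "card (A \<inter> S) \<le> card S" by (intro card_mono) (auto simp: S_def)
    also have "\<dots> \<le> 4" unfolding S_def by (intro card_insert_le_m1) auto
    finally show "real (card (A \<inter> S)) \<le> 4" by simp
  qed fact
  finally show ?thesis .
qed

lemma norm_resonant_pair: "norm (Wiener (resonant_pair N)) \<le> 4"
proof (rule norm_wiener_leI)
  fix A :: "int set" assume "finite A"
  have "cmod (resonant_pair N n) = 1 * (cmod (resonant_pair N n))\<^sup>2" for n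
    by (simp add: resonant_pair_def)
  then show "(\<Sum>n\<in>A. cmod (coeff (Wiener (resonant_pair N)) n)) \<le> 4"
    using sum_resonant_pair_le[OF \<open>finite A\<close>, of N "\<lambda>_. 1" 1] by (simp add: coeff_resonant_pair)
qed

lemma resonant_pair_interaction:
  assumes "N \<ge> 1"
  shows "coeff (conv (Wiener (resonant_pair N)) (Wiener (resonant_pair N))) 1 = 2"
proof -
  have "coeff (conv (Wiener (resonant_pair N)) (Wiener (resonant_pair N))) 1
    = (\<Sum>\<^sub>\<infinity>m\<in>{int N + 1, - int N}. resonant_pair N m * resonant_pair N (1 - m))"
    unfolding coeff_conv coeff_resonant_pair
    by (intro infsum_cong_neutral) (use assms in \<open>auto simp: resonant_pair_def\<close>)
  also have "\<dots> = 2"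
    by (simp add: resonant_pair_def)
  finally show ?thesis .
qed

lemma conv_low_high:
  assumes p: "\<And>n. \<bar>n\<bar> > int K \<Longrightarrow> coeff p n = 0" and "K + 1 < N"
  shows "coeff (conv p (Wiener (resonant_pair N))) 1 = 0"
    and "coeff (conv (Wiener (resonant_pair N)) p) 1 = 0"
proof -
  have 0: "coeff p m * resonant_pair N (1 - m) = 0" "resonant_pair N m * coeff p (1 - m) = 0" for m
    using p[of m] p[of "1 - m"] \<open>K + 1 < N\<close> by (auto simp: resonant_pair_def)
  show "coeff (conv p (Wiener (resonant_pair N))) 1 = 0"
    and "coeff (conv (Wiener (resonant_pair N)) p) 1 = 0"
    by (simp_all only: coeff_conv coeff_resonant_pair 0 infsum_0_simp)
qed

text \<open>
  At time \<open>1 / (1000 A)\<close> the resonance has moved the first mode by \<open>A / 2000 = 4 A / 8000\<close>, while the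
  error in the expansion takes away at most \<open>A / 8000\<close> and bounded terms.
\<close>

lemma first_mode_growth:
  assumes p: "\<And>n. \<bar>n\<bar> > int K \<Longrightarrow> coeff p n = 0" and "K + 1 < N"
    and A: "A \<ge> 1" "norm p \<le> A" "(norm p)\<^sup>2 \<le> A"
    and flow: "bbm_flow (\<lambda>_. 1) x" and x0: "x 0 = p + A *\<^sub>R Wiener (resonant_pair N)"
  shows "cmod (coeff (x (1 / (1000 * A))) 1) \<ge> 3 / 8000 * A - 1 - norm p"
proof -
  define t where "t = 1 / (1000 * A)"
  define h where "h = Wiener (resonant_pair N)"
  have "norm (x 0) \<le> norm p + A * 4"
    unfolding x0 using norm_resonant_pair[of N] A(1)
    by (intro norm_triangle_mono) (auto intro!: mult_left_mono)
  then have "norm (x 0) \<le> 5 * A" using A by simp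
  from first_mode_expansion[OF flow A(1) this t_def]
  have 1: "cmod (coeff (x t) 1 - coeff (x 0) 1 + \<i> / 4 * of_real t * coeff (conv (x 0) (x 0)) 1)
    \<le> 1 / 100 + A / 8000" .
  have N: "N \<ge> 1" using \<open>K + 1 < N\<close> by simp
  have q: "coeff (conv (x 0) (x 0)) 1 = coeff (conv p p) 1 + of_real (2 * A\<^sup>2)"
    unfolding x0 h_def[symmetric]
    using conv_low_high[OF p \<open>K + 1 < N\<close>] resonant_pair_interaction[OF N]
    by (simp add: conv.add_left conv.add_right conv.scaleR_left conv.scaleR_right h_def
        scaleR_conv_of_real power2_eq_square)
  have e: "coeff (x 0) 1 = coeff p 1"
    using \<open>K + 1 < N\<close> by (simp add: x0 coeff_resonant_pair resonant_pair_def)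
  have t: "t * (2 * A\<^sup>2) = A / 500" "t \<ge> 0"
    using A by (simp_all add: t_def power2_eq_square)
  have m: "\<i> / 4 * of_real t * coeff (conv (x 0) (x 0)) 1
    = \<i> / 4 * of_real t * coeff (conv p p) 1 + \<i> / 4 * of_real (A / 500)"
    unfolding q t(1)[symmetric] by (simp add: algebra_simps)
  have tri: "cmod w \<le> cmod y + cmod z + cmod v + cmod (y - z + (v + w))" for w y z v
  proof -
    have "w = (y - z + (v + w)) + ((z - y) - v)" by simp
    then have "cmod w \<le> cmod (y - z + (v + w)) + cmod ((z - y) - v)"
      by (metis norm_triangle_ineq)
    then show ?thesis
      using norm_triangle_ineq4[of "z - y" v] norm_triangle_ineq4[of z y] by linarith
  qed
  have "cmod (\<i> / 4 * of_real t * coeff (conv p p) 1) \<le> 1 / 4000"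
  proof -
    have "cmod (coeff (conv p p) 1) \<le> A"
      using coeff_le_norm[of "conv p p" 1] norm_conv_le[of p p] A(3) by (simp add: power2_eq_square)
    then have "t * cmod (coeff (conv p p) 1) \<le> t * A" using t by (intro mult_left_mono) auto
    also have "t * A = 1 / 1000" using A by (simp add: t_def)
    finally show ?thesis using t by (simp add: norm_mult norm_divide)
  qed
  moreover have "cmod (\<i> / 4 * of_real (A / 500)) = A / 2000"
    using A by (simp add: norm_mult norm_divide)
  moreover have "cmod (coeff (x 0) 1) \<le> norm p" unfolding e by (rule coeff_le_norm)
  ultimately have "A / 2000 \<le> cmod (coeff (x t) 1) + norm p + 1 / 4000 + (1 / 100 + A / 8000)"
    using tri[of "\<i> / 4 * of_real (A / 500)" "coeff (x t) 1" "coeff (x 0) 1"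
        "\<i> / 4 * of_real t * coeff (conv p p) 1"] 1[unfolded m]
    by linarith
  then show ?thesis unfolding t_def[symmetric] by simp
qed

section \<open>Sobolev norms\<close>

lemma square_powr: "((a::real) powr r)\<^sup>2 = a powr (2 * r)"
  by (simp only: power2_eq_square powr_add[symmetric] mult_2)

lemma L2_set_le_Hs_norm:
  assumes "f \<in> Hs \<sigma>" "finite A"
  shows "L2_set (\<lambda>n. jap n powr \<sigma> * cmod (f n)) A \<le> Hs_norm \<sigma> f"
proof -
  have "(\<Sum>n\<in>A. (jap n powr \<sigma> * cmod (f n))\<^sup>2) = (\<Sum>n\<in>A. jap n powr (2 * \<sigma>) * (cmod (f n))\<^sup>2)"
    by (simp add: power_mult_distrib square_powr mult.commute)
  also have "\<dots> \<le> (\<Sum>\<^sub>\<infinity>n. jap n powr (2 * \<sigma>) * (cmod (f n))\<^sup>2)"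
    using assms by (intro finite_sum_le_infsum) (auto simp: Hs_def)
  finally show ?thesis unfolding L2_set_def Hs_norm_def by (rule real_sqrt_le_mono)
qed

lemma Hs_normI:
  assumes B: "\<And>A. finite A \<Longrightarrow> (\<Sum>n\<in>A. jap n powr (2 * \<sigma>) * (cmod (f n))\<^sup>2) \<le> B\<^sup>2" and "B \<ge> 0"
  shows "f \<in> Hs \<sigma>" "Hs_norm \<sigma> f \<le> B"
proof -
  have s: "(\<lambda>n. jap n powr (2 * \<sigma>) * (cmod (f n))\<^sup>2) summable_on UNIV"
    by (intro nonneg_bdd_above_summable_on) (auto simp: bdd_above_def intro: B)
  then show "f \<in> Hs \<sigma>" by (simp add: Hs_def)
  have "(\<Sum>\<^sub>\<infinity>n. jap n powr (2 * \<sigma>) * (cmod (f n))\<^sup>2) \<le> B\<^sup>2"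
    by (intro infsum_le_finite_sums s B)
  then show "Hs_norm \<sigma> f \<le> B"
    unfolding Hs_norm_def using \<open>B \<ge> 0\<close> by (intro real_le_lsqrt) (auto intro: infsum_nonneg)
qed

lemma Hs_triangle:
  assumes "f \<in> Hs \<sigma>" "h \<in> Hs \<sigma>"
  shows "(\<lambda>n. f n + h n) \<in> Hs \<sigma>" "Hs_norm \<sigma> (\<lambda>n. f n + h n) \<le> Hs_norm \<sigma> f + Hs_norm \<sigma> h"
proof -
  have le: "(\<Sum>n\<in>A. jap n powr (2 * \<sigma>) * (cmod (f n + h n))\<^sup>2) \<le> (Hs_norm \<sigma> f + Hs_norm \<sigma> h)\<^sup>2"
    if "finite A" for A
  proof -
    have "(\<Sum>n\<in>A. jap n powr (2 * \<sigma>) * (cmod (f n + h n))\<^sup>2)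
      = (L2_set (\<lambda>n. jap n powr \<sigma> * cmod (f n + h n)) A)\<^sup>2"
      by (simp add: L2_set_def sum_nonneg power_mult_distrib square_powr mult.commute)
    also have "\<dots> \<le> (L2_set (\<lambda>n. jap n powr \<sigma> * cmod (f n) + jap n powr \<sigma> * cmod (h n)) A)\<^sup>2"
      by (intro power_mono L2_set_mono)
         (auto simp: norm_triangle_ineq simp flip: distrib_left intro!: mult_left_mono)
    also have "\<dots> \<le> (Hs_norm \<sigma> f + Hs_norm \<sigma> h)\<^sup>2"
      by (intro power_mono order.trans[OF L2_set_triangle_ineq] add_mono L2_set_le_Hs_norm assms that) simp
    finally show ?thesis .
  qed
  have nonneg: "0 \<le> Hs_norm \<sigma> f + Hs_norm \<sigma> h" by (intro add_nonneg_nonneg Hs_norm_nonneg)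
  show "(\<lambda>n. f n + h n) \<in> Hs \<sigma>" by (rule Hs_normI(1)[OF le nonneg])
  show "Hs_norm \<sigma> (\<lambda>n. f n + h n) \<le> Hs_norm \<sigma> f + Hs_norm \<sigma> h"
    by (rule Hs_normI(2)[OF le nonneg])
qed

lemma Hs_uminus: "f \<in> Hs \<sigma> \<Longrightarrow> (\<lambda>n. - f n) \<in> Hs \<sigma>" "Hs_norm \<sigma> (\<lambda>n. - f n) = Hs_norm \<sigma> f"
  by (simp_all add: Hs_def Hs_norm_def)

lemma Hs_diff:
  assumes "f \<in> Hs \<sigma>" "h \<in> Hs \<sigma>"
  shows "(\<lambda>n. f n - h n) \<in> Hs \<sigma>" "Hs_norm \<sigma> (\<lambda>n. f n - h n) \<le> Hs_norm \<sigma> f + Hs_norm \<sigma> h"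
  using Hs_triangle[OF assms(1) Hs_uminus(1)[OF assms(2)]] by (simp_all add: Hs_uminus(2))

lemma mode_le_Hs_norm:
  assumes "f \<in> Hs \<sigma>"
  shows "jap n powr \<sigma> * cmod (f n) \<le> Hs_norm \<sigma> f"
  using L2_set_le_Hs_norm[OF assms, of "{n}"] by (simp add: L2_set_def)

lemma CHs_subset: "u \<in> CHs I \<sigma> \<Longrightarrow> I' \<subseteq> I \<Longrightarrow> u \<in> CHs I' \<sigma>"
  unfolding CHs_def by (blast intro: tendsto_within_subset)

lemma CHs_bounded:
  assumes u: "u \<in> CHs {a..b} \<sigma>"
  shows "\<exists>B. \<forall>t\<in>{a..b}. Hs_norm \<sigma> (u t) \<le> B"
proof -
  have uH: "u t \<in> Hs \<sigma>" if "t \<in> {a..b}" for t using u that by (simp add: CHs_def)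
  have "continuous_on {a..b} (\<lambda>t. Hs_norm \<sigma> (u t))"
    unfolding continuous_on_def
  proof
    fix t assume t: "t \<in> {a..b}"
    have lim: "((\<lambda>t'. Hs_norm \<sigma> (\<lambda>n. u t' n - u t n)) \<longlongrightarrow> 0) (at t within {a..b})"
      using u t by (simp add: CHs_def)
    have "\<bar>Hs_norm \<sigma> (u t') - Hs_norm \<sigma> (u t)\<bar> \<le> Hs_norm \<sigma> (\<lambda>n. u t' n - u t n)"
      if t': "t' \<in> {a..b}" for t'
      using Hs_triangle(2)[OF Hs_diff(1)[OF uH[OF t'] uH[OF t]] uH[OF t]]
        Hs_triangle(2)[OF Hs_diff(1)[OF uH[OF t] uH[OF t']] uH[OF t']]
        Hs_norm_minus_commute[of \<sigma> "u t'" "u t"] by simp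
    then have "\<forall>\<^sub>F t' in at t within {a..b}.
        norm (Hs_norm \<sigma> (u t') - Hs_norm \<sigma> (u t)) \<le> Hs_norm \<sigma> (\<lambda>n. u t' n - u t n)"
      unfolding eventually_at by (intro exI[of _ 1]) auto
    from Lim_null_comparison[OF this lim]
    show "((\<lambda>t. Hs_norm \<sigma> (u t)) \<longlongrightarrow> Hs_norm \<sigma> (u t)) (at t within {a..b})"
      by (simp add: LIM_zero_iff)
  qed
  then have "bounded ((\<lambda>t. Hs_norm \<sigma> (u t)) ` {a..b})"
    by (intro compact_imp_bounded compact_continuous_image) auto
  then show ?thesis by (auto simp: bounded_iff abs_le_iff)
qed

text \<open>
  The tail of the convergent series that defines the norm is small beyond a finite set of frequencies,
  and a large enough symmetric interval contains this set.
\<close>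

lemma frequency_truncation_converges:
  assumes f: "f \<in> Hs \<sigma>" and "e > 0"
  obtains K where "Hs_norm \<sigma> (\<lambda>n. frequency_truncation K f n - f n) \<le> e"
    and "(\<lambda>n. frequency_truncation K f n - f n) \<in> Hs \<sigma>"
proof -
  define w where "w n = jap n powr (2 * \<sigma>) * (cmod (f n))\<^sup>2" for n
  have w: "w summable_on UNIV" "\<And>n. w n \<ge> 0" using f by (auto simp: w_def[abs_def] Hs_def)
  obtain F where F: "finite F" "dist (sum w F) (infsum w UNIV) \<le> e\<^sup>2"
    using infsum_finite_approximation[OF w(1), of "e\<^sup>2"] \<open>e > 0\<close> by auto
  define K where "K = nat (Max (abs ` insert 0 F))"
  have "\<bar>n\<bar> \<le> Max (abs ` insert 0 F)" if "n \<in> F" for n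
    using F that by (intro Max_ge) auto
  then have K: "\<bar>n\<bar> \<le> int K" if "n \<in> F" for n using that by (fastforce simp: K_def)
  have le: "(\<Sum>n\<in>A. jap n powr (2 * \<sigma>) * (cmod (frequency_truncation K f n - f n))\<^sup>2) \<le> e\<^sup>2"
    if A: "finite A" for A
  proof -
    have "(\<Sum>n\<in>A. jap n powr (2 * \<sigma>) * (cmod (frequency_truncation K f n - f n))\<^sup>2) \<le> sum w (A - F)"
      using A K
      by (subst sum.mono_neutral_right[of A "A - F"])
         (auto simp: frequency_truncation_def w_def intro!: sum_mono)
    also have "\<dots> = sum w (F \<union> (A - F)) - sum w F"
      using A F by (subst sum.union_disjoint) auto
    also have "\<dots> \<le> infsum w UNIV - sum w F"
      using A F w by (intro diff_right_mono finite_sum_le_infsum) auto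
    also have "\<dots> \<le> e\<^sup>2" using F(2) by (simp add: dist_real_def)
    finally show ?thesis .
  qed
  show ?thesis
    using Hs_normI[OF le] \<open>e > 0\<close> by (intro that[of K]) auto
qed

lemma resonant_pair_Hs:
  assumes "\<sigma> \<le> 0" "N \<ge> 1" "A \<ge> 0"
  shows "(\<lambda>n. of_real A * resonant_pair N n) \<in> Hs \<sigma>"
    and "Hs_norm \<sigma> (\<lambda>n. of_real A * resonant_pair N n) \<le> 2 * A * real N powr \<sigma>"
proof -
  have v: "jap n powr (2 * \<sigma>) * A\<^sup>2 \<le> (A * real N powr \<sigma>)\<^sup>2" if "\<bar>n\<bar> \<ge> int N" for n
  proof -
    have "(real N)\<^sup>2 \<le> (real_of_int n)\<^sup>2" using that by (intro abs_le_square_iff[THEN iffD1]) auto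
    then have "real N \<le> jap n" unfolding jap_def by (intro real_le_rsqrt) simp
    then have "jap n powr (2 * \<sigma>) \<le> real N powr (2 * \<sigma>)"
      using assms by (intro powr_mono2') auto
    then have "jap n powr (2 * \<sigma>) * A\<^sup>2 \<le> real N powr (2 * \<sigma>) * A\<^sup>2" by (intro mult_right_mono) auto
    also have "\<dots> = (A * real N powr \<sigma>)\<^sup>2" by (simp add: power_mult_distrib square_powr mult.commute)
    finally show ?thesis .
  qed
  have le: "(\<Sum>n\<in>S. jap n powr (2 * \<sigma>) * (cmod (of_real A * resonant_pair N n))\<^sup>2)
      \<le> (2 * A * real N powr \<sigma>)\<^sup>2" if "finite S" for S
    using sum_resonant_pair_le[OF that v] by (simp add: norm_mult power_mult_distrib mult_ac)
  show "(\<lambda>n. of_real A * resonant_pair N n) \<in> Hs \<sigma>"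
    and "Hs_norm \<sigma> (\<lambda>n. of_real A * resonant_pair N n) \<le> 2 * A * real N powr \<sigma>"
    using Hs_normI[OF le] assms by auto
qed

section \<open>Norm inflation\<close>

text \<open>
  The order of the choices matters: the truncation of \<open>u0\<close> is fixed first, then \<open>A\<close> is taken large
  compared with its norm, and finally \<open>N\<close> is taken large enough to make \<open>A N\<^sup>\<sigma>\<close> small and to keep
  the high frequencies from interacting with the truncated datum at frequency 1.
\<close>

lemma norm_inflation:
  assumes u0: "u0 \<in> Hs \<sigma>" "real_valued u0" and "\<sigma> < 0" "\<delta> > 0"
  obtains y t where "smooth_bbm_solution y" "Hs_norm \<sigma> (\<lambda>n. y 0 n - u0 n) < \<delta>"
    "0 \<le> t" "t < \<delta>" "cmod (y t 1) \<ge> B"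
proof -
  obtain K where K: "Hs_norm \<sigma> (\<lambda>n. frequency_truncation K u0 n - u0 n) \<le> \<delta> / 3"
    "(\<lambda>n. frequency_truncation K u0 n - u0 n) \<in> Hs \<sigma>"
    using frequency_truncation_converges[OF u0(1), of "\<delta> / 3"] \<open>\<delta> > 0\<close> by auto
  define p where "p = Wiener (frequency_truncation K u0)"
  have p: "coeff p = frequency_truncation K u0"
    unfolding p_def using u0(2)
    by (intro coeff_Wiener_bounded_support[of K])
       (auto simp: frequency_truncation_def real_valued_def)
  have p0: "coeff p n = 0" if "\<bar>n\<bar> > int K" for n using that by (simp add: p frequency_truncation_def)
  define A where "A = 1 + norm p + (norm p)\<^sup>2 + 1 / \<delta> + 4000 * (\<bar>B\<bar> + 1 + norm p)"
  have A: "A \<ge> 1" "norm p \<le> A" "(norm p)\<^sup>2 \<le> A" "1 / \<delta> \<le> A" "4000 * (\<bar>B\<bar> + 1 + norm p) \<le> A"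
    using \<open>\<delta> > 0\<close> by (simp_all add: A_def)
  have "(\<lambda>N. 2 * A * real N powr \<sigma>) \<longlonglongrightarrow> 2 * A * 0"
    by (rule tendsto_mult[OF tendsto_const tendsto_neg_powr[OF \<open>\<sigma> < 0\<close> filterlim_real_sequentially]])
  then have "\<forall>\<^sub>F N in sequentially. 2 * A * real N powr \<sigma> < \<delta> / 3"
    using \<open>\<delta> > 0\<close> by (elim order_tendstoD(2)) simp
  moreover have "\<forall>\<^sub>F N in sequentially. K + 1 < N" by (rule eventually_gt_at_top)
  ultimately have "\<exists>N. 2 * A * real N powr \<sigma> < \<delta> / 3 \<and> K + 1 < N"
    by (intro eventually_happens'[OF sequentially_bot] eventually_conj)
  then obtain N where N: "2 * A * real N powr \<sigma> < \<delta> / 3" "K + 1 < N" by blast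
  define w where "w = p + A *\<^sub>R Wiener (resonant_pair N)"
  have w: "coeff w n = frequency_truncation K u0 n + of_real A * resonant_pair N n" for n
    by (simp add: w_def p coeff_resonant_pair scaleR_conv_of_real)
  have "rapid_decay (coeff w)"
    using N(2) by (intro rapid_decay_bounded_support[of "N + 1"])
      (auto simp: w frequency_truncation_def resonant_pair_def)
  from bbm_global_flow[OF this] obtain x where x: "x 0 = w" "bbm_flow (\<lambda>_. 1) x" by blast
  show ?thesis
  proof (rule that[of "\<lambda>t. coeff (x t)" "1 / (1000 * A)"])
    show "smooth_bbm_solution (\<lambda>t. coeff (x t))"
      using x \<open>rapid_decay (coeff w)\<close> by (intro flow_smooth_bbm_solution) auto
    have R: "(\<lambda>n. of_real A * resonant_pair N n) \<in> Hs \<sigma>"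
      "Hs_norm \<sigma> (\<lambda>n. of_real A * resonant_pair N n) \<le> 2 * A * real N powr \<sigma>"
      using resonant_pair_Hs[of \<sigma> N A] A(1) N(2) \<open>\<sigma> < 0\<close> by auto
    have eq: "(\<lambda>n. coeff (x 0) n - u0 n)
        = (\<lambda>n. (frequency_truncation K u0 n - u0 n) + of_real A * resonant_pair N n)"
      by (simp add: x w fun_eq_iff)
    have "Hs_norm \<sigma> (\<lambda>n. coeff (x 0) n - u0 n) \<le> \<delta> / 3 + 2 * A * real N powr \<sigma>"
      unfolding eq using Hs_triangle(2)[OF K(2) R(1)] K(1) R(2) by linarith
    then show "Hs_norm \<sigma> (\<lambda>n. coeff (x 0) n - u0 n) < \<delta>" using N(1) \<open>\<delta> > 0\<close> by simp
    show "0 \<le> 1 / (1000 * A)" using A(1) by simp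
    have "1 \<le> A * \<delta>" using A(4) \<open>\<delta> > 0\<close> by (simp add: field_simps)
    then show "1 / (1000 * A) < \<delta>" using A(1) by (simp add: field_simps)
    have "B \<le> \<bar>B\<bar>" by simp
    also have "\<dots> \<le> 3 / 8000 * A - 1 - norm p"
      using A(5) norm_ge_zero[of p] abs_ge_zero[of B] by argo
    also have "\<dots> \<le> cmod (coeff (x (1 / (1000 * A))) 1)"
      using p0 N(2) A x(2) by (intro first_mode_growth[of K p N]) (auto simp: x w_def)
    finally show "B \<le> cmod (coeff (x (1 / (1000 * A))) 1)" .
  qed
qed

lemma random_data_real_valued:
  assumes "standard_gaussians M g" "\<omega> \<in> space M"
  shows "real_valued (random_data g \<alpha> \<omega>)"
  using assms by (simp add: real_valued_def random_data_def standard_gaussians_def jap_def)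

theorem theorem1p10:
  fixes M :: "'w measure"
    and g :: "int \<Rightarrow> 'w \<Rightarrow> complex"
    and \<alpha> s \<epsilon> :: real
    and Q :: "'w \<Rightarrow> real \<Rightarrow> fourier"
    and Sig :: "'w set"
    and T :: "'w \<Rightarrow> real"
    and u :: "'w \<Rightarrow> real \<Rightarrow> fourier"
    and \<omega> :: 'w
  assumes "prob_space M"
    and "standard_gaussians M g"
    and "1 / 4 < \<alpha>" and "\<alpha> \<le> 1 / 2"
    and "1 / 2 - \<alpha> < s" and "s < 2 * \<alpha>"
    and "0 < \<epsilon>"
    and "L2_limit_square M (random_linear g \<alpha>) Q"
    and "Sig \<in> sets M" and "measure M Sig = 1"
    and "\<And>\<eta>. \<eta> \<in> Sig \<Longrightarrow> 0 < T \<eta>"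
    and "\<And>\<eta>. \<eta> \<in> Sig \<Longrightarrow> unique_class_solution (T \<eta>) s (random_data g \<alpha> \<eta>) (Q \<eta>) (u \<eta>)"
    and "\<And>\<eta>. \<eta> \<in> Sig \<Longrightarrow>
      solution_class (T \<eta>) s (random_data g \<alpha> \<eta>) \<subseteq> CHs {0..T \<eta>} (\<alpha> - 1 / 2 - \<epsilon>)"
    and "\<omega> \<in> Sig"
  shows "\<exists>uk :: nat \<Rightarrow> real \<Rightarrow> fourier.
    (\<forall>k. smooth_bbm_solution (uk k)) \<and>
    (\<lambda>k. Hs_norm (\<alpha> - 1 / 2 - \<epsilon>) (\<lambda>n. uk k 0 n - random_data g \<alpha> \<omega> n)) \<longlonglongrightarrow> 0 \<and>
    filterlim
      (\<lambda>k. SUP t\<in>{0..1 / real k}. Hs_norm (\<alpha> - 1 / 2 - \<epsilon>) (\<lambda>n. uk k t n - u \<omega> t n))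
      at_top sequentially"
proof -
  define \<sigma> where "\<sigma> = \<alpha> - 1 / 2 - \<epsilon>"
  define u0 where "u0 = random_data g \<alpha> \<omega>"
  have "\<sigma> < 0" using assms(4,7) by (simp add: \<sigma>_def)
  have "\<omega> \<in> space M" using assms(9,14) sets.sets_into_space by blast
  then have "real_valued u0" using assms(2) unfolding u0_def by (rule random_data_real_valued[rotated])
  have sol: "class_solution (T \<omega>) s u0 (Q \<omega>) (u \<omega>)"
    using assms(12)[OF assms(14)] by (simp add: unique_class_solution_def u0_def)
  then have u: "u \<omega> \<in> CHs {0..T \<omega>} \<sigma>" and "u \<omega> 0 = u0"
    using assms(13)[OF assms(14)] by (auto simp: class_solution_def u0_def \<sigma>_def)
  have "T \<omega> > 0" using assms(11,14) by blast
  have uH: "u \<omega> t \<in> Hs \<sigma>" if "t \<in> {0..T \<omega>}" for t using u that by (simp add: CHs_def)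
  then have "u0 \<in> Hs \<sigma>" using \<open>u \<omega> 0 = u0\<close> \<open>T \<omega> > 0\<close> by force
  obtain B where B: "\<And>t. t \<in> {0..T \<omega>} \<Longrightarrow> Hs_norm \<sigma> (u \<omega> t) \<le> B"
    using CHs_bounded[OF u] by blast
  define J where "J = jap 1 powr \<sigma>"
  have "J > 0" using jap_ge_1[of 1] by (simp add: J_def)
  define good where "good k y t \<longleftrightarrow>
      smooth_bbm_solution y \<and> Hs_norm \<sigma> (\<lambda>n. y 0 n - u0 n) < 1 / real (Suc k) \<and>
      0 \<le> t \<and> t < 1 / real (Suc k) \<and> cmod (y t 1) \<ge> (B + real k) / J" for k y t
  have "\<exists>y t. good k y t" for k
  proof -
    have "1 / real (Suc k) > 0" by simp
    from norm_inflation[OF \<open>u0 \<in> Hs \<sigma>\<close> \<open>real_valued u0\<close> \<open>\<sigma> < 0\<close> this, of "(B + real k) / J"]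
    show ?thesis unfolding good_def by blast
  qed
  then obtain y t where "good k (y k) (t k)" for k by metis
  then have y: "\<And>k. smooth_bbm_solution (y k)"
      "\<And>k. Hs_norm \<sigma> (\<lambda>n. y k 0 n - u0 n) < 1 / real (Suc k)"
    and t: "\<And>k. 0 \<le> t k" "\<And>k. t k < 1 / real (Suc k)" "\<And>k. cmod (y k (t k) 1) \<ge> (B + real k) / J"
    unfolding good_def by blast+
  \<comment> \<open>\<open>Sup\<close> on the reals is meaningful only for bounded sets: hence the bound \<open>C + B\<close> below\<close>
  define S where "S k = (SUP t\<in>{0..1 / real k}. Hs_norm \<sigma> (\<lambda>n. y k t n - u \<omega> t n))" for k
  have "(\<lambda>k. Hs_norm \<sigma> (\<lambda>n. y k 0 n - u0 n)) \<longlonglongrightarrow> 0"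
    by (rule tendsto_sandwich[OF _ _ tendsto_const lim_1_over_n[THEN LIMSEQ_Suc]])
       (auto intro!: always_eventually less_imp_le y(2) simp: Hs_norm_nonneg simp del: of_nat_Suc)
  moreover have "filterlim S at_top sequentially"
  proof (rule filterlim_at_top_mono[OF filterlim_real_sequentially])
    have "\<forall>\<^sub>F k in sequentially. 1 / real k < T \<omega>"
      using lim_1_over_n \<open>T \<omega> > 0\<close> by (rule order_tendstoD)
    then show "\<forall>\<^sub>F k in sequentially. real k \<le> S k"
      using eventually_gt_at_top[of 0]
    proof eventually_elim
      case (elim k)
      have yC: "y k \<in> CHs {0..} \<sigma>" using y(1)[of k] by (simp add: smooth_bbm_solution_def)
      then have yH: "y k r \<in> Hs \<sigma>" if "r \<ge> 0" for r using that by (simp add: CHs_def)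
      have "y k \<in> CHs {0..1 / real k} \<sigma>"
        using yC by (rule CHs_subset) auto
      then obtain C where C: "\<And>r. r \<in> {0..1 / real k} \<Longrightarrow> Hs_norm \<sigma> (y k r) \<le> C"
        using CHs_bounded by blast
      have "bdd_above ((\<lambda>t. Hs_norm \<sigma> (\<lambda>n. y k t n - u \<omega> t n)) ` {0..1 / real k})"
      proof (rule bdd_aboveI2)
        fix r assume r: "r \<in> {0..1 / real k}"
        then have "r \<in> {0..T \<omega>}" using elim by auto
        then show "Hs_norm \<sigma> (\<lambda>n. y k r n - u \<omega> r n) \<le> C + B"
          using Hs_diff(2)[OF yH uH, of r r] C[OF r] B[of r] by auto
      qed
      moreover have tk: "t k \<in> {0..1 / real k}"
      proof -
        have "1 / real (Suc k) \<le> 1 / real k" using elim by (intro divide_left_mono) auto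
        then show ?thesis using t(1,2)[of k] by simp
      qed
      ultimately have upper: "Hs_norm \<sigma> (\<lambda>n. y k (t k) n - u \<omega> (t k) n) \<le> S k"
        unfolding S_def by (intro cSUP_upper)
      have tT: "t k \<in> {0..T \<omega>}" using tk elim by auto
      have "B + real k \<le> J * cmod (y k (t k) 1)"
        using t(3)[of k] \<open>J > 0\<close> by (simp add: pos_divide_le_eq mult.commute)
      also have "\<dots> \<le> J * cmod (y k (t k) 1 - u \<omega> (t k) 1) + J * cmod (u \<omega> (t k) 1)"
        unfolding distrib_left[symmetric] using \<open>J > 0\<close> norm_triangle_sub[of "y k (t k) 1" "u \<omega> (t k) 1"]
        by (intro mult_left_mono) (auto simp: add.commute)
      also have "\<dots> \<le> Hs_norm \<sigma> (\<lambda>n. y k (t k) n - u \<omega> (t k) n) + B"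
        using mode_le_Hs_norm[OF Hs_diff(1)[OF yH[OF t(1)[of k]] uH[OF tT]], of 1]
          mode_le_Hs_norm[OF uH[OF tT], of 1] B[OF tT] by (simp add: J_def)
      finally show "real k \<le> S k" using upper by simp
    qed
  qed
  ultimately show ?thesis
    using y(1) unfolding S_def[abs_def] u0_def \<sigma>_def by blast
qed

end
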